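(* Let $\mathcal{E}$ be an essentially small exact category and let $\mathcal{G}$ be a family of objects of $\mathcal{E}$ which is a generator or a cogenerator of $\mathcal{E}$. For a full additive subcategory $\mathcal{X}$ of $\mathcal{E}$ put $f(\mathcal{X}) := \langle [X] \mid X \in \mathcal{X}\rangle$, the subgroup of the Grothendieck group $K_0(\mathcal{E})$ generated by the classes of the objects of $\mathcal{X}$, and for a subgroup $H$ of $K_0(\mathcal{E})$ let $g(H) := \{X \in \mathcal{E} \mid [X] \in H\}$ (a full subcategory of $\mathcal{E}$). Then $f$ and $g$ give a one-to-one correspondence (mutually inverse bijections) between the set of dense $\mathcal{G}$-resolving subcategories of $\mathcal{E}$ and the set of subgroups of $K_0(\mathcal{E})$ containing the image of $\mathcal{G}$ (that is, containing $[G]$ for all $G \in \mathcal{G}$). Likewise, $f$ and $g$ give a one-to-one correspondence between the set of dense $\mathcal{G}$-coresolving subcategories of $\mathcal{E}$ and the set of subgroups of $K_0(\mathcal{E})$ containing the image of $\mathcal{G}$.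
   Context: All subcategories are full and additive. A short exact sequence (conflation) in an exact category $\mathcal{E}$ is written $X \rightarrowtail Y \twoheadrightarrow Z$. A family $\mathcal{G}$ of objects of $\mathcal{E}$ is a generator (resp. cogenerator) of $\mathcal{E}$ if for every object $A \in \mathcal{E}$ there is a short exact sequence $A' \rightarrowtail G \twoheadrightarrow A$ (resp. $A \rightarrowtail G \twoheadrightarrow A'$) in $\mathcal{E}$ with $G \in \mathcal{G}$. A subcategory $\mathcal{X}$ of $\mathcal{E}$ is dense if every object of $\mathcal{E}$ is a direct summand of some object of $\mathcal{X}$. A subcategory $\mathcal{X}$ is $\mathcal{G}$-resolving if (i) it is closed under extensions: for a short exact sequence $X \rightarrowtail Y \twoheadrightarrow Z$ in $\mathcal{E}$ with $X, Z \in \mathcal{X}$ one has $Y \in \mathcal{X}$; (ii) it is closed under kernels of admissible epimorphisms: for such a sequence with $Y, Z \in \mathcal{X}$ one has $X \in \mathcal{X}$; (iii) $\mathcal{G} \subseteq \mathcal{X}$. It is $\mathcal{G}$-coresolving if (i) and (iii) hold and (ii') it is closed under cokernels of admissible monomorphisms: for such a sequence with $X, Y \in \mathcal{X}$ one has $Z \in \mathcal{X}$. Closure under direct summands is not required. The Grothendieck group $K_0(\mathcal{E})$ is the free abelian group on isomorphism classes of objects of $\mathcal{E}$ modulo the subgroup generated by the elements $[A]-[B]+[C]$ for all short exact sequences $A \rightarrowtail B \twoheadrightarrow C$ in $\mathcal{E}$. *)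

theory Defs
  imports "HOL-Algebra.Free_Abelian_Groups"
begin

section \<open>Additive categories\<close>

text \<open>Objects and morphisms are carrier \<^emph>\<open>sets\<close> over arbitrary types, so every category considered
  here is small; an essentially small category is covered through any small category equivalent
  to it.\<close>

record ('o, 'm) category_data =
  Obj :: "'o set"
  Arr :: "'m set"
  Src :: "'m \<Rightarrow> 'o"
  Tgt :: "'m \<Rightarrow> 'o"
  Ident :: "'o \<Rightarrow> 'm"
  Cmp :: "'m \<Rightarrow> 'm \<Rightarrow> 'm"  (infixl \<open>\<cdot>\<index>\<close> 75)

record ('o, 'm) preadditive_data = "('o, 'm) category_data" +
  Plus :: "'m \<Rightarrow> 'm \<Rightarrow> 'm"
  Null :: "'o \<Rightarrow> 'o \<Rightarrow> 'm"

definition Hom :: "('o, 'm, 'z) category_data_scheme \<Rightarrow> 'o \<Rightarrow> 'o \<Rightarrow> 'm set" where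
  "Hom E A B = {f \<in> Arr E. Src E f = A \<and> Tgt E f = B}"

definition Hom_group :: "('o, 'm, 'z) preadditive_data_scheme \<Rightarrow> 'o \<Rightarrow> 'o \<Rightarrow> 'm monoid" where
  "Hom_group E A B = \<lparr>carrier = Hom E A B, monoid.mult = Plus E, one = Null E A B\<rparr>"

locale is_category =
  fixes E :: "('o, 'm, 'z) category_data_scheme" (structure)
  assumes Src_in_Obj: "f \<in> Arr E \<Longrightarrow> Src E f \<in> Obj E"
    and Tgt_in_Obj: "f \<in> Arr E \<Longrightarrow> Tgt E f \<in> Obj E"
    and Ident_in_Hom: "A \<in> Obj E \<Longrightarrow> Ident E A \<in> Hom E A A"
    and Cmp_in_Hom: "\<lbrakk>f \<in> Hom E A B; g \<in> Hom E B C\<rbrakk> \<Longrightarrow> g \<cdot> f \<in> Hom E A C"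
    and Cmp_Ident_right: "f \<in> Hom E A B \<Longrightarrow> f \<cdot> Ident E A = f"
    and Cmp_Ident_left: "f \<in> Hom E A B \<Longrightarrow> Ident E B \<cdot> f = f"
    and Cmp_assoc: "\<lbrakk>f \<in> Hom E A B; g \<in> Hom E B C; h \<in> Hom E C D\<rbrakk> \<Longrightarrow> h \<cdot> (g \<cdot> f) = (h \<cdot> g) \<cdot> f"

locale preadditive_category = is_category E
  for E :: "('o, 'm, 'z) preadditive_data_scheme" (structure) +
  assumes Hom_comm_group: "\<lbrakk>A \<in> Obj E; B \<in> Obj E\<rbrakk> \<Longrightarrow> comm_group (Hom_group E A B)"
    and Cmp_Plus_left: "\<lbrakk>f \<in> Hom E A B; g \<in> Hom E B C; h \<in> Hom E B C\<rbrakk>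
      \<Longrightarrow> Plus E g h \<cdot> f = Plus E (g \<cdot> f) (h \<cdot> f)"
    and Cmp_Plus_right: "\<lbrakk>f \<in> Hom E A B; g \<in> Hom E A B; h \<in> Hom E B C\<rbrakk>
      \<Longrightarrow> h \<cdot> Plus E f g = Plus E (h \<cdot> f) (h \<cdot> g)"

definition zero_object :: "('o, 'm, 'z) category_data_scheme \<Rightarrow> 'o \<Rightarrow> bool" where
  "zero_object E Z \<longleftrightarrow> Z \<in> Obj E \<and>
     (\<forall>A \<in> Obj E. (\<exists>!f. f \<in> Hom E A Z) \<and> (\<exists>!f. f \<in> Hom E Z A))"

text \<open>\<open>P\<close> is a biproduct of \<open>A\<close> and \<open>B\<close>; the arguments \<open>i j\<close> are the injections and \<open>p q\<close> the
  projections.\<close>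

definition biproduct_via ::
  "('o, 'm, 'z) preadditive_data_scheme \<Rightarrow> 'o \<Rightarrow> 'o \<Rightarrow> 'o \<Rightarrow> 'm \<Rightarrow> 'm \<Rightarrow> 'm \<Rightarrow> 'm \<Rightarrow> bool" where
  "biproduct_via E A B P i j p q \<longleftrightarrow>
     i \<in> Hom E A P \<and> j \<in> Hom E B P \<and> p \<in> Hom E P A \<and> q \<in> Hom E P B \<and>
     p \<cdot>\<^bsub>E\<^esub> i = Ident E A \<and> q \<cdot>\<^bsub>E\<^esub> j = Ident E B \<and>
     q \<cdot>\<^bsub>E\<^esub> i = Null E A B \<and> p \<cdot>\<^bsub>E\<^esub> j = Null E B A \<and>
     Plus E (i \<cdot>\<^bsub>E\<^esub> p) (j \<cdot>\<^bsub>E\<^esub> q) = Ident E P"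

definition biproduct :: "('o, 'm, 'z) preadditive_data_scheme \<Rightarrow> 'o \<Rightarrow> 'o \<Rightarrow> 'o \<Rightarrow> bool" where
  "biproduct E A B P \<longleftrightarrow> (\<exists>i j p q. biproduct_via E A B P i j p q)"

locale additive_category = preadditive_category E
  for E :: "('o, 'm, 'z) preadditive_data_scheme" (structure) +
  assumes ex_zero_object: "\<exists>Z. zero_object E Z"
    and ex_biproduct: "\<lbrakk>A \<in> Obj E; B \<in> Obj E\<rbrakk> \<Longrightarrow> \<exists>P \<in> Obj E. biproduct E A B P"

definition iso_arrow :: "('o, 'm, 'z) category_data_scheme \<Rightarrow> 'o \<Rightarrow> 'o \<Rightarrow> 'm \<Rightarrow> bool" where
  "iso_arrow E A B f \<longleftrightarrow> f \<in> Hom E A B \<and>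
     (\<exists>g \<in> Hom E B A. g \<cdot>\<^bsub>E\<^esub> f = Ident E A \<and> f \<cdot>\<^bsub>E\<^esub> g = Ident E B)"

definition isomorphic :: "('o, 'm, 'z) category_data_scheme \<Rightarrow> 'o \<Rightarrow> 'o \<Rightarrow> bool" where
  "isomorphic E A B \<longleftrightarrow> (\<exists>f. iso_arrow E A B f)"


section \<open>Exact categories\<close>

definition is_kernel ::
  "('o, 'm, 'z) preadditive_data_scheme \<Rightarrow> 'o \<Rightarrow> 'o \<Rightarrow> 'o \<Rightarrow> 'm \<Rightarrow> 'm \<Rightarrow> bool" where
  "is_kernel E A B C i p \<longleftrightarrow> i \<in> Hom E A B \<and> p \<in> Hom E B C \<and> p \<cdot>\<^bsub>E\<^esub> i = Null E A C \<and>
     (\<forall>T \<in> Obj E. \<forall>h \<in> Hom E T B. p \<cdot>\<^bsub>E\<^esub> h = Null E T C \<longrightarrow>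
        (\<exists>!k. k \<in> Hom E T A \<and> i \<cdot>\<^bsub>E\<^esub> k = h))"

definition is_cokernel ::
  "('o, 'm, 'z) preadditive_data_scheme \<Rightarrow> 'o \<Rightarrow> 'o \<Rightarrow> 'o \<Rightarrow> 'm \<Rightarrow> 'm \<Rightarrow> bool" where
  "is_cokernel E A B C i p \<longleftrightarrow> i \<in> Hom E A B \<and> p \<in> Hom E B C \<and> p \<cdot>\<^bsub>E\<^esub> i = Null E A C \<and>
     (\<forall>T \<in> Obj E. \<forall>h \<in> Hom E B T. h \<cdot>\<^bsub>E\<^esub> i = Null E A T \<longrightarrow>
        (\<exists>!k. k \<in> Hom E C T \<and> k \<cdot>\<^bsub>E\<^esub> p = h))"

definition is_pushout ::
  "('o, 'm, 'z) category_data_scheme \<Rightarrow> 'o \<Rightarrow> 'o \<Rightarrow> 'o \<Rightarrow> 'o \<Rightarrow> 'm \<Rightarrow> 'm \<Rightarrow> 'm \<Rightarrow> 'm \<Rightarrow> bool" where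
  \<comment> \<open>the square \<open>A \<rightarrow> B\<close> (\<open>i\<close>), \<open>A \<rightarrow> A'\<close> (\<open>f\<close>), \<open>A' \<rightarrow> P\<close> (\<open>i'\<close>), \<open>B \<rightarrow> P\<close> (\<open>f'\<close>)\<close>
  "is_pushout E A B A' P i f i' f' \<longleftrightarrow>
     i \<in> Hom E A B \<and> f \<in> Hom E A A' \<and> i' \<in> Hom E A' P \<and> f' \<in> Hom E B P \<and>
     i' \<cdot>\<^bsub>E\<^esub> f = f' \<cdot>\<^bsub>E\<^esub> i \<and>
     (\<forall>T \<in> Obj E. \<forall>u \<in> Hom E A' T. \<forall>v \<in> Hom E B T. u \<cdot>\<^bsub>E\<^esub> f = v \<cdot>\<^bsub>E\<^esub> i \<longrightarrow>
        (\<exists>!k. k \<in> Hom E P T \<and> k \<cdot>\<^bsub>E\<^esub> i' = u \<and> k \<cdot>\<^bsub>E\<^esub> f' = v))"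

definition is_pullback ::
  "('o, 'm, 'z) category_data_scheme \<Rightarrow> 'o \<Rightarrow> 'o \<Rightarrow> 'o \<Rightarrow> 'o \<Rightarrow> 'm \<Rightarrow> 'm \<Rightarrow> 'm \<Rightarrow> 'm \<Rightarrow> bool" where
  \<comment> \<open>the square \<open>B \<rightarrow> C\<close> (\<open>p\<close>), \<open>C' \<rightarrow> C\<close> (\<open>f\<close>), \<open>P \<rightarrow> C'\<close> (\<open>p'\<close>), \<open>P \<rightarrow> B\<close> (\<open>f'\<close>)\<close>
  "is_pullback E B C C' P p f p' f' \<longleftrightarrow>
     p \<in> Hom E B C \<and> f \<in> Hom E C' C \<and> p' \<in> Hom E P C' \<and> f' \<in> Hom E P B \<and>
     f \<cdot>\<^bsub>E\<^esub> p' = p \<cdot>\<^bsub>E\<^esub> f' \<and>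
     (\<forall>T \<in> Obj E. \<forall>u \<in> Hom E T C'. \<forall>v \<in> Hom E T B. f \<cdot>\<^bsub>E\<^esub> u = p \<cdot>\<^bsub>E\<^esub> v \<longrightarrow>
        (\<exists>!k. k \<in> Hom E T P \<and> p' \<cdot>\<^bsub>E\<^esub> k = u \<and> f' \<cdot>\<^bsub>E\<^esub> k = v))"

record ('o, 'm) exact_data = "('o, 'm) preadditive_data" +
  Confl :: "('m \<times> 'm) set"

definition adm_mono :: "('o, 'm, 'z) exact_data_scheme \<Rightarrow> 'm \<Rightarrow> bool" where
  "adm_mono E i \<longleftrightarrow> (\<exists>p. (i, p) \<in> Confl E)"

definition adm_epi :: "('o, 'm, 'z) exact_data_scheme \<Rightarrow> 'm \<Rightarrow> bool" where
  "adm_epi E p \<longleftrightarrow> (\<exists>i. (i, p) \<in> Confl E)"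

text \<open>Quillen's axioms in the self-dual form of Buehler (Exact categories, Definition 2.1).\<close>

locale exact_category = additive_category E
  for E :: "('o, 'm, 'z) exact_data_scheme" (structure) +
  assumes Confl_kernel_cokernel: "(i, p) \<in> Confl E \<Longrightarrow>
      \<exists>A B C. is_kernel E A B C i p \<and> is_cokernel E A B C i p"
    and Confl_iso_closed: "\<lbrakk>(i, p) \<in> Confl E; i \<in> Hom E A B; p \<in> Hom E B C;
        i' \<in> Hom E A' B'; p' \<in> Hom E B' C';
        iso_arrow E A A' a; iso_arrow E B B' b; iso_arrow E C C' c;
        i' \<cdot> a = b \<cdot> i; p' \<cdot> b = c \<cdot> p\<rbrakk> \<Longrightarrow> (i', p') \<in> Confl E"
    and adm_mono_Ident: "A \<in> Obj E \<Longrightarrow> adm_mono E (Ident E A)"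
    and adm_epi_Ident: "A \<in> Obj E \<Longrightarrow> adm_epi E (Ident E A)"
    and adm_mono_Cmp: "\<lbrakk>adm_mono E f; adm_mono E g; f \<in> Hom E A B; g \<in> Hom E B C\<rbrakk>
        \<Longrightarrow> adm_mono E (g \<cdot> f)"
    and adm_epi_Cmp: "\<lbrakk>adm_epi E f; adm_epi E g; f \<in> Hom E A B; g \<in> Hom E B C\<rbrakk>
        \<Longrightarrow> adm_epi E (g \<cdot> f)"
    and adm_mono_pushout: "\<lbrakk>adm_mono E i; i \<in> Hom E A B; f \<in> Hom E A A'\<rbrakk>
        \<Longrightarrow> \<exists>P i' f'. is_pushout E A B A' P i f i' f' \<and> adm_mono E i'"
    and adm_epi_pullback: "\<lbrakk>adm_epi E p; p \<in> Hom E B C; f \<in> Hom E C' C\<rbrakk>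
        \<Longrightarrow> \<exists>P p' f'. is_pullback E B C C' P p f p' f' \<and> adm_epi E p'"

definition ses :: "('o, 'm, 'z) exact_data_scheme \<Rightarrow> 'o \<Rightarrow> 'o \<Rightarrow> 'o \<Rightarrow> bool" where
  \<comment> \<open>there is a short exact sequence with terms \<open>X\<close>, \<open>Y\<close>, \<open>Z\<close>\<close>
  "ses E X Y Z \<longleftrightarrow> (\<exists>i p. (i, p) \<in> Confl E \<and> i \<in> Hom E X Y \<and> p \<in> Hom E Y Z)"


section \<open>Subcategories\<close>

text \<open>A full subcategory is given by its set of objects.  Closure under isomorphism is not
  part of the definition of an additive subcategory.\<close>

definition additive_subcategory :: "('o, 'm, 'z) preadditive_data_scheme \<Rightarrow> 'o set \<Rightarrow> bool" where
  "additive_subcategory E X \<longleftrightarrow> X \<subseteq> Obj E \<and> (\<exists>Z \<in> X. zero_object E Z) \<and>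
     (\<forall>A \<in> X. \<forall>B \<in> X. \<exists>P \<in> X. biproduct E A B P)"

definition is_generator :: "('o, 'm, 'z) exact_data_scheme \<Rightarrow> 'o set \<Rightarrow> bool" where
  "is_generator E \<G> \<longleftrightarrow> (\<forall>A \<in> Obj E. \<exists>A' \<in> Obj E. \<exists>G \<in> \<G>. ses E A' G A)"

definition is_cogenerator :: "('o, 'm, 'z) exact_data_scheme \<Rightarrow> 'o set \<Rightarrow> bool" where
  "is_cogenerator E \<G> \<longleftrightarrow> (\<forall>A \<in> Obj E. \<exists>A' \<in> Obj E. \<exists>G \<in> \<G>. ses E A G A')"

definition direct_summand :: "('o, 'm, 'z) preadditive_data_scheme \<Rightarrow> 'o \<Rightarrow> 'o \<Rightarrow> bool" where
  "direct_summand E A X \<longleftrightarrow> (\<exists>B \<in> Obj E. biproduct E A B X)"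

definition dense_in :: "('o, 'm, 'z) preadditive_data_scheme \<Rightarrow> 'o set \<Rightarrow> bool" where
  "dense_in E X \<longleftrightarrow> (\<forall>A \<in> Obj E. \<exists>B \<in> X. direct_summand E A B)"

definition closed_under_extensions :: "('o, 'm, 'z) exact_data_scheme \<Rightarrow> 'o set \<Rightarrow> bool" where
  "closed_under_extensions E \<X> \<longleftrightarrow> (\<forall>X Y Z. ses E X Y Z \<longrightarrow> X \<in> \<X> \<longrightarrow> Z \<in> \<X> \<longrightarrow> Y \<in> \<X>)"

definition closed_under_kernels :: "('o, 'm, 'z) exact_data_scheme \<Rightarrow> 'o set \<Rightarrow> bool" where
  "closed_under_kernels E \<X> \<longleftrightarrow> (\<forall>X Y Z. ses E X Y Z \<longrightarrow> Y \<in> \<X> \<longrightarrow> Z \<in> \<X> \<longrightarrow> X \<in> \<X>)"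

definition closed_under_cokernels :: "('o, 'm, 'z) exact_data_scheme \<Rightarrow> 'o set \<Rightarrow> bool" where
  "closed_under_cokernels E \<X> \<longleftrightarrow> (\<forall>X Y Z. ses E X Y Z \<longrightarrow> X \<in> \<X> \<longrightarrow> Y \<in> \<X> \<longrightarrow> Z \<in> \<X>)"

definition resolving :: "('o, 'm, 'z) exact_data_scheme \<Rightarrow> 'o set \<Rightarrow> 'o set \<Rightarrow> bool" where
  "resolving E \<G> \<X> \<longleftrightarrow> additive_subcategory E \<X> \<and>
     closed_under_extensions E \<X> \<and> closed_under_kernels E \<X> \<and> \<G> \<subseteq> \<X>"

definition coresolving :: "('o, 'm, 'z) exact_data_scheme \<Rightarrow> 'o set \<Rightarrow> 'o set \<Rightarrow> bool" where
  "coresolving E \<G> \<X> \<longleftrightarrow> additive_subcategory E \<X> \<and>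
     closed_under_extensions E \<X> \<and> closed_under_cokernels E \<X> \<and> \<G> \<subseteq> \<X>"


section \<open>The Grothendieck group\<close>

definition iso_class :: "('o, 'm, 'z) category_data_scheme \<Rightarrow> 'o \<Rightarrow> 'o set" where
  "iso_class E A = {B \<in> Obj E. isomorphic E A B}"

definition iso_free_group :: "('o, 'm, 'z) category_data_scheme \<Rightarrow> ('o set \<Rightarrow>\<^sub>0 int) monoid" where
  "iso_free_group E = free_Abelian_group (iso_class E ` Obj E)"

definition K0_relations :: "('o, 'm, 'z) exact_data_scheme \<Rightarrow> ('o set \<Rightarrow>\<^sub>0 int) set" where
  "K0_relations E = generate (iso_free_group E)
     {frag_of (iso_class E A) - frag_of (iso_class E B) + frag_of (iso_class E C) | A B C. ses E A B C}"

definition K0 :: "('o, 'm, 'z) exact_data_scheme \<Rightarrow> ('o set \<Rightarrow>\<^sub>0 int) set monoid" where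
  "K0 E = iso_free_group E Mod K0_relations E"

definition K0_class :: "('o, 'm, 'z) exact_data_scheme \<Rightarrow> 'o \<Rightarrow> ('o set \<Rightarrow>\<^sub>0 int) set" where
  "K0_class E A = K0_relations E #>\<^bsub>iso_free_group E\<^esub> frag_of (iso_class E A)"

definition K0_span :: "('o, 'm, 'z) exact_data_scheme \<Rightarrow> 'o set \<Rightarrow> ('o set \<Rightarrow>\<^sub>0 int) set set" where
  \<comment> \<open>the map \<open>f\<close> of the correspondence\<close>
  "K0_span E \<X> = generate (K0 E) (K0_class E ` \<X>)"

definition K0_preimage :: "('o, 'm, 'z) exact_data_scheme \<Rightarrow> ('o set \<Rightarrow>\<^sub>0 int) set set \<Rightarrow> 'o set" where
  \<comment> \<open>the map \<open>g\<close> of the correspondence\<close>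
  "K0_preimage E H = {A \<in> Obj E. K0_class E A \<in> H}"

definition mutually_inverse_bijections ::
  "('a \<Rightarrow> 'b) \<Rightarrow> ('b \<Rightarrow> 'a) \<Rightarrow> 'a set \<Rightarrow> 'b set \<Rightarrow> bool" where
  "mutually_inverse_bijections f g S T \<longleftrightarrow> bij_betw f S T \<and> bij_betw g T S \<and>
     (\<forall>x \<in> S. g (f x) = x) \<and> (\<forall>y \<in> T. f (g y) = y)"

end

theory Submission
  imports Defs
begin

text \<open>The class map \<open>K0_class\<close> is additive on short exact sequences, so \<open>K0_preimage E H\<close> is always closed
  under extensions, kernels and cokernels. The content is that \<open>K0_preimage\<close> and \<open>K0_span\<close> undo each
  other, and both halves use complements to replace differences by objects.

  \<^bold>\<open>From subcategories to subgroups and back.\<close> Let \<open>\<X>\<close> be dense, closed under extensions, and closed under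
  kernels or under cokernels. If \<open>[A]\<close> lies in the span of \<open>\<X>\<close>, then \<open>A \<in> \<X>\<close> must follow, and
  for this one needs an additive invariant of objects that vanishes exactly on \<open>\<X>\<close>. Consider the
  commutative monoid of isomorphism classes under \<open>\<oplus>\<close> and in it the submonoid \<open>S\<close> of classes of objects of
  \<open>\<X>\<close>. Density says that every class has a complement in \<open>S\<close>, and closure under kernels or cokernels,
  applied to the split sequences of \<open>A \<oplus> X\<close>, says that \<open>A \<oplus> X \<in> \<X>\<close> and \<open>X \<in> \<X>\<close> give \<open>A \<in> \<X>\<close>.
  Hence the syntactic congruence of \<open>S\<close> has a group \<open>Q\<close> as quotient, and the class of \<open>S\<close> is the neutral element
  (\<open>comm_monoid.ex_group_hom_with_kernel\<close>). The map to \<open>Q\<close> is additive also on sequences that do not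
  split: for \<open>A \<rightarrow> B \<rightarrow> C\<close> choose complements with \<open>A \<oplus> A' \<in> \<X>\<close> and \<open>C \<oplus> C' \<in> \<X>\<close>; in the
  short exact sequence \<open>A \<oplus> A' \<rightarrow> B \<oplus> A' \<oplus> C' \<rightarrow> C \<oplus> C'\<close> the outer terms lie in \<open>\<X>\<close>, hence so does the
  middle one, and in \<open>Q\<close> this reads \<open>B = A + C\<close> (\<open>exact_category.ex_additive_invariant_detecting\<close>). By the
  universal property of \<open>K0\<close> the invariant factors through a homomorphism on \<open>K0 E\<close> whose kernel contains the span of \<open>\<X>\<close>,
  and the classes of objects in that kernel are those of the objects of \<open>\<X>\<close>.

  \<^bold>\<open>From subgroups to subcategories and back.\<close> A generator or cogenerator gives, for every \<open>A\<close>, an object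
  \<open>B\<close> and some \<open>G \<in> \<G>\<close> with \<open>[A \<oplus> B] = [G]\<close>. If \<open>H\<close> contains all these \<open>[G]\<close>, then \<open>A\<close> is a summand of
  \<open>A \<oplus> B\<close> in the preimage of \<open>H\<close>, so the preimage is dense. An element of \<open>H\<close> is a difference
  \<open>[A] - [B]\<close>; with \<open>[B \<oplus> B'] = [G]\<close> it equals \<open>[A \<oplus> B'] - [B \<oplus> B']\<close>, where both classes lie in \<open>H\<close>. So the
  objects in the preimage of \<open>H\<close> generate \<open>H\<close>.

  The preimage of a subgroup is resolving and coresolving at once, and the first half uses either of the two closure
  conditions; so one argument serves both correspondences.\<close>

section \<open>Quotients of commutative monoids that are groups\<close>

text \<open>The quotient is by the syntactic congruence of \<open>S\<close>: two elements are identified if the same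
  elements carry them into \<open>S\<close>. An element is therefore represented by the set \<open>\<phi> a\<close> of all \<open>c\<close> with
  \<open>a \<otimes> c \<in> S\<close>. Cofinality of \<open>S\<close> supplies inverses, since \<open>\<phi>\<close> is constant on \<open>S\<close>.\<close>
lemma (in comm_monoid) ex_group_hom_with_kernel:
  assumes S: "S \<subseteq> carrier G" "\<one> \<in> S" "\<And>s t. s \<in> S \<Longrightarrow> t \<in> S \<Longrightarrow> s \<otimes> t \<in> S"
    and cofinal: "\<And>a. a \<in> carrier G \<Longrightarrow> \<exists>b\<in>carrier G. a \<otimes> b \<in> S"
    and saturated: "\<And>a s. a \<in> carrier G \<Longrightarrow> s \<in> S \<Longrightarrow> a \<otimes> s \<in> S \<Longrightarrow> a \<in> S"
  shows "\<exists>(Q :: 'a set monoid) \<phi>. comm_group Q \<and> \<phi> \<in> hom G Q \<and>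
    (\<forall>a\<in>carrier G. \<phi> a = \<one>\<^bsub>Q\<^esub> \<longleftrightarrow> a \<in> S)"
proof -
  define \<phi> where "\<phi> a = {c \<in> carrier G. a \<otimes> c \<in> S}" for a
  define Q where "Q = \<lparr>carrier = \<phi> ` carrier G,
    monoid.mult = (\<lambda>U V. {c \<in> carrier G. \<exists>a\<in>carrier G. \<exists>b\<in>carrier G. U = \<phi> a \<and> V = \<phi> b \<and> a \<otimes> b \<otimes> c \<in> S}),
    one = \<phi> \<one>\<rparr>"
  \<comment> \<open>the two factors are replaced one at a time\<close>
  have swap: "a \<otimes> b \<otimes> c \<in> S \<longleftrightarrow> a' \<otimes> b' \<otimes> c \<in> S"
    if "a \<in> carrier G" "b \<in> carrier G" "a' \<in> carrier G" "b' \<in> carrier G" "c \<in> carrier G"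
      "\<phi> a = \<phi> a'" "\<phi> b = \<phi> b'" for a b a' b' c
  proof -
    have "a \<otimes> b \<otimes> c \<in> S \<longleftrightarrow> b \<otimes> c \<in> \<phi> a" "a' \<otimes> b \<otimes> c \<in> S \<longleftrightarrow> b \<otimes> c \<in> \<phi> a'"
      "a' \<otimes> b \<otimes> c \<in> S \<longleftrightarrow> a' \<otimes> c \<in> \<phi> b" "a' \<otimes> b' \<otimes> c \<in> S \<longleftrightarrow> a' \<otimes> c \<in> \<phi> b'"
      using that(1-5) by (auto simp: \<phi>_def m_ac)
    then show ?thesis using that by simp
  qed
  have mult: "\<phi> a \<otimes>\<^bsub>Q\<^esub> \<phi> b = \<phi> (a \<otimes> b)" if "a \<in> carrier G" "b \<in> carrier G" for a b
  proof -
    have "(\<exists>a'\<in>carrier G. \<exists>b'\<in>carrier G. \<phi> a = \<phi> a' \<and> \<phi> b = \<phi> b' \<and> a' \<otimes> b' \<otimes> c \<in> S)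
        \<longleftrightarrow> a \<otimes> b \<otimes> c \<in> S" if "c \<in> carrier G" for c
      using that swap \<open>a \<in> carrier G\<close> \<open>b \<in> carrier G\<close> by blast
    then show ?thesis unfolding \<phi>_def[of "a \<otimes> b"] by (simp add: Q_def cong: conj_cong)
  qed
  have one: "\<phi> a = \<phi> \<one> \<longleftrightarrow> a \<in> S" if "a \<in> carrier G" for a
  proof
    assume "\<phi> a = \<phi> \<one>"
    then have "\<one> \<in> \<phi> a" using S by (simp add: \<phi>_def)
    then show "a \<in> S" using that by (simp add: \<phi>_def)
  next
    assume "a \<in> S"
    have "a \<otimes> c \<in> S \<longleftrightarrow> c \<in> S" if "c \<in> carrier G" for c
      using S(3)[OF \<open>a \<in> S\<close>, of c] saturated[OF that \<open>a \<in> S\<close>] m_comm[OF that \<open>a \<in> carrier G\<close>] by auto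
    then show "\<phi> a = \<phi> \<one>" by (auto simp: \<phi>_def)
  qed
  have carr: "carrier Q = \<phi> ` carrier G" "\<one>\<^bsub>Q\<^esub> = \<phi> \<one>" by (simp_all add: Q_def)
  have "comm_group Q"
  proof (rule comm_groupI)
    fix x assume "x \<in> carrier Q"
    then obtain a where a: "a \<in> carrier G" "x = \<phi> a" by (auto simp: carr)
    then obtain b where "b \<in> carrier G" "a \<otimes> b \<in> S" using cofinal by blast
    with a have "\<phi> b \<otimes>\<^bsub>Q\<^esub> x = \<one>\<^bsub>Q\<^esub>" by (simp add: carr mult one m_comm[of a])
    then show "\<exists>y\<in>carrier Q. y \<otimes>\<^bsub>Q\<^esub> x = \<one>\<^bsub>Q\<^esub>" using \<open>b \<in> carrier G\<close> by (auto simp: carr)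
  qed (auto simp: carr mult m_ac)
  moreover have "\<phi> \<in> hom G Q" by (auto simp: hom_def carr mult)
  ultimately show ?thesis using one carr by metis
qed

section \<open>Arrows of a preadditive category\<close>

text \<open>Membership in \<open>Hom\<close> leaves the middle object of a composite implicit, which a rewrite rule cannot
  guess. Stated through \<open>Src\<close> and \<open>Tgt\<close>, the category axioms have side conditions that rewriting decides.\<close>
lemma Hom_iff: "f \<in> Hom E A B \<longleftrightarrow> f \<in> Arr E \<and> Src E f = A \<and> Tgt E f = B"
  by (simp add: Hom_def)

context is_category
begin

lemma Cmp_Arr:
  assumes "f \<in> Arr E" "g \<in> Arr E" "Src E g = Tgt E f"
  shows "g \<cdot> f \<in> Arr E" "Src E (g \<cdot> f) = Src E f" "Tgt E (g \<cdot> f) = Tgt E g"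
  using Cmp_in_Hom[of f "Src E f" "Tgt E f" g "Tgt E g"] assms by (auto simp: Hom_iff)

lemma Ident_Arr:
  assumes "A \<in> Obj E"
  shows "Ident E A \<in> Arr E" "Src E (Ident E A) = A" "Tgt E (Ident E A) = A"
  using Ident_in_Hom[OF assms] by (auto simp: Hom_iff)

lemma Cmp_Ident:
  assumes "f \<in> Arr E"
  shows "Src E f = A \<Longrightarrow> f \<cdot> Ident E A = f" "Tgt E f = B \<Longrightarrow> Ident E B \<cdot> f = f"
  using assms Cmp_Ident_right Cmp_Ident_left by (auto simp: Hom_iff)

lemma Cmp_assoc_right:
  assumes "f \<in> Arr E" "g \<in> Arr E" "h \<in> Arr E" "Src E g = Tgt E f" "Src E h = Tgt E g"
  shows "(h \<cdot> g) \<cdot> f = h \<cdot> (g \<cdot> f)"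
  using Cmp_assoc[of f "Src E f" "Tgt E f" g "Tgt E g" h "Tgt E h"] assms by (auto simp: Hom_iff)

text \<open>With composites associated to the right, an equation \<open>p \<cdot> i = z\<close> no longer matches inside
  \<open>p \<cdot> (i \<cdot> x)\<close>; composing the equation with this rule yields the rewrite rule for that position.\<close>
lemma Cmp_Cmp_eq:
  assumes "p \<cdot> i = z" "i \<in> Arr E" "p \<in> Arr E" "Src E p = Tgt E i" "x \<in> Arr E" "Src E i = Tgt E x"
  shows "p \<cdot> (i \<cdot> x) = z \<cdot> x"
  using assms Cmp_assoc_right by auto

lemmas arrow_simps = Src_in_Obj Tgt_in_Obj Cmp_Arr Ident_Arr Cmp_Ident Cmp_assoc_right

end

context preadditive_category
begin

lemma Null_Arr:
  assumes "A \<in> Obj E" "B \<in> Obj E"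
  shows "Null E A B \<in> Arr E" "Src E (Null E A B) = A" "Tgt E (Null E A B) = B"
proof -
  interpret comm_group "Hom_group E A B" using Hom_comm_group assms .
  show "Null E A B \<in> Arr E" "Src E (Null E A B) = A" "Tgt E (Null E A B) = B"
    using one_closed by (auto simp: Hom_group_def Hom_iff)
qed

lemma Plus_Arr:
  assumes "f \<in> Arr E" "g \<in> Arr E" "Src E g = Src E f" "Tgt E g = Tgt E f"
  shows "Plus E f g \<in> Arr E" "Src E (Plus E f g) = Src E f" "Tgt E (Plus E f g) = Tgt E f"
proof -
  interpret comm_group "Hom_group E (Src E f) (Tgt E f)"
    using Hom_comm_group Src_in_Obj Tgt_in_Obj assms by blast
  show "Plus E f g \<in> Arr E" "Src E (Plus E f g) = Src E f" "Tgt E (Plus E f g) = Tgt E f"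
    using m_closed[of f g] assms by (auto simp: Hom_group_def Hom_iff)
qed

lemma Plus_Null:
  assumes "f \<in> Arr E" "Src E f = A" "Tgt E f = B"
  shows "Plus E f (Null E A B) = f" "Plus E (Null E A B) f = f"
proof -
  interpret comm_group "Hom_group E A B"
    using Hom_comm_group Src_in_Obj Tgt_in_Obj assms by blast
  show "Plus E f (Null E A B) = f" "Plus E (Null E A B) f = f"
    using r_one[of f] l_one[of f] assms by (auto simp: Hom_group_def Hom_iff)
qed

lemma Plus_comm:
  assumes "f \<in> Arr E" "g \<in> Arr E" "Src E g = Src E f" "Tgt E g = Tgt E f"
  shows "Plus E f g = Plus E g f"
proof -
  interpret comm_group "Hom_group E (Src E f) (Tgt E f)"
    using Hom_comm_group Src_in_Obj Tgt_in_Obj assms by blast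
  show ?thesis
    using m_comm[of f g] assms by (auto simp: Hom_group_def Hom_iff)
qed

lemma Plus_assoc:
  assumes "f \<in> Arr E" "g \<in> Arr E" "h \<in> Arr E" "Src E g = Src E f" "Tgt E g = Tgt E f"
    "Src E h = Src E f" "Tgt E h = Tgt E f"
  shows "Plus E (Plus E f g) h = Plus E f (Plus E g h)"
proof -
  interpret comm_group "Hom_group E (Src E f) (Tgt E f)"
    using Hom_comm_group Src_in_Obj Tgt_in_Obj assms by blast
  show ?thesis
    using m_assoc[of f g h] assms by (auto simp: Hom_group_def Hom_iff)
qed

lemma Cmp_Plus:
  assumes "f \<in> Arr E" "g \<in> Arr E" "h \<in> Arr E" "Src E g = Src E f" "Tgt E g = Tgt E f"
  shows "Src E h = Tgt E f \<Longrightarrow> h \<cdot> Plus E f g = Plus E (h \<cdot> f) (h \<cdot> g)"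
    and "Tgt E h = Src E f \<Longrightarrow> Plus E f g \<cdot> h = Plus E (f \<cdot> h) (g \<cdot> h)"
  using Cmp_Plus_right[of f "Src E f" "Tgt E f" g h "Tgt E h"]
    Cmp_Plus_left[of h "Src E h" "Src E f" f "Tgt E f" g] assms by (auto simp: Hom_iff)

lemma Cmp_Null:
  assumes "f \<in> Arr E" "A \<in> Obj E"
  shows "Src E f = B \<Longrightarrow> f \<cdot> Null E A B = Null E A (Tgt E f)"
    and "Tgt E f = B \<Longrightarrow> Null E B A \<cdot> f = Null E (Src E f) A"
proof -
  \<comment> \<open>in a group, \<open>x + x = x\<close> forces \<open>x = 0\<close>; a composite with a zero arrow has this property by bilinearity\<close>
  have idem: "x = Null E C D"
    if "x \<in> Arr E" "Src E x = C" "Tgt E x = D" "Plus E x x = x" for x C D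
  proof -
    interpret comm_group "Hom_group E C D"
      using Hom_comm_group Src_in_Obj Tgt_in_Obj that by blast
    show ?thesis using l_cancel_one[of x x] that by (auto simp: Hom_group_def Hom_iff)
  qed
  show "f \<cdot> Null E A B = Null E A (Tgt E f)" if "Src E f = B"
    using Cmp_Plus(1)[of "Null E A B" "Null E A B" f] assms that
    by (intro idem) (auto simp: arrow_simps Null_Arr Plus_Null)
  show "Null E B A \<cdot> f = Null E (Src E f) A" if "Tgt E f = B"
    using Cmp_Plus(2)[of "Null E B A" "Null E B A" f] assms that
    by (intro idem) (auto simp: arrow_simps Null_Arr Plus_Null)
qed

lemmas additive_simps = arrow_simps Null_Arr Plus_Arr Plus_Null Cmp_Plus Cmp_Null

end

section \<open>Isomorphisms and biproducts\<close>

context preadditive_category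
begin

lemma isomorphic_refl: "A \<in> Obj E \<Longrightarrow> isomorphic E A A"
  unfolding isomorphic_def iso_arrow_def
  by (rule exI[of _ "Ident E A"]) (auto simp: Hom_iff arrow_simps intro!: bexI[of _ "Ident E A"])

lemma isomorphicE:
  assumes "isomorphic E A B"
  obtains f g where "f \<in> Arr E" "Src E f = A" "Tgt E f = B" "g \<in> Arr E" "Src E g = B" "Tgt E g = A"
    "g \<cdot> f = Ident E A" "f \<cdot> g = Ident E B"
  using assms unfolding isomorphic_def iso_arrow_def by (auto simp: Hom_iff)

lemma isomorphic_Obj:
  assumes "isomorphic E A B"
  shows "A \<in> Obj E" "B \<in> Obj E"
  using assms Src_in_Obj Tgt_in_Obj by (auto elim!: isomorphicE)

lemma isomorphicI:
  assumes "f \<in> Arr E" "Src E f = A" "Tgt E f = B" "g \<in> Arr E" "Src E g = B" "Tgt E g = A"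
    "g \<cdot> f = Ident E A" "f \<cdot> g = Ident E B"
  shows "isomorphic E A B"
  unfolding isomorphic_def iso_arrow_def
  by (rule exI[of _ f], intro conjI bexI[of _ g]) (use assms in \<open>auto simp: Hom_iff\<close>)

lemma isomorphic_sym: "isomorphic E A B \<Longrightarrow> isomorphic E B A"
  by (metis isomorphicE isomorphicI)

lemma isomorphic_trans:
  assumes "isomorphic E A B" "isomorphic E B C"
  shows "isomorphic E A C"
proof -
  obtain f g where 1: "f \<in> Arr E" "Src E f = A" "Tgt E f = B" "g \<in> Arr E" "Src E g = B" "Tgt E g = A"
    and 2: "g \<cdot> f = Ident E A" "f \<cdot> g = Ident E B"
    using assms(1) by (rule isomorphicE)
  obtain h k where 3: "h \<in> Arr E" "Src E h = B" "Tgt E h = C" "k \<in> Arr E" "Src E k = C" "Tgt E k = B"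
    and 4: "k \<cdot> h = Ident E B" "h \<cdot> k = Ident E C"
    using assms(2) by (rule isomorphicE)
  show ?thesis
    by (rule isomorphicI[of "h \<cdot> f" _ _ "g \<cdot> k"])
      (use 1 2 3 4 in \<open>auto simp: arrow_simps Cmp_Cmp_eq[OF 2(2)] Cmp_Cmp_eq[OF 4(1)]\<close>)
qed

lemma iso_class_eq_iff:
  assumes "A \<in> Obj E" "B \<in> Obj E"
  shows "iso_class E A = iso_class E B \<longleftrightarrow> isomorphic E A B"
  using assms isomorphic_refl isomorphic_sym isomorphic_trans unfolding iso_class_def by blast

lemma biproduct_via_iff:
  "biproduct_via E A B P i j p q \<longleftrightarrow>
     i \<in> Arr E \<and> Src E i = A \<and> Tgt E i = P \<and> j \<in> Arr E \<and> Src E j = B \<and> Tgt E j = P \<and>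
     p \<in> Arr E \<and> Src E p = P \<and> Tgt E p = A \<and> q \<in> Arr E \<and> Src E q = P \<and> Tgt E q = B \<and>
     p \<cdot> i = Ident E A \<and> q \<cdot> j = Ident E B \<and>
     q \<cdot> i = Null E A B \<and> p \<cdot> j = Null E B A \<and>
     Plus E (i \<cdot> p) (j \<cdot> q) = Ident E P"
  by (auto simp: biproduct_via_def Hom_iff)

lemma biproduct_Obj:
  assumes "biproduct E A B P"
  shows "A \<in> Obj E" "B \<in> Obj E" "P \<in> Obj E"
  using assms Src_in_Obj Tgt_in_Obj unfolding biproduct_def biproduct_via_iff by blast+

lemma biproduct_via_sym: "biproduct_via E A B P i j p q \<Longrightarrow> biproduct_via E B A P j i q p"
  unfolding biproduct_via_iff using Plus_comm[of "i \<cdot> p" "j \<cdot> q"]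
  by (auto simp: arrow_simps)

lemma biproduct_sym: "biproduct E A B P \<Longrightarrow> biproduct E B A P"
  unfolding biproduct_def using biproduct_via_sym by blast

lemma biproduct_via_Arr:
  assumes "biproduct_via E A B P i j p q"
  shows "i \<in> Arr E" "Src E i = A" "Tgt E i = P" "j \<in> Arr E" "Src E j = B" "Tgt E j = P"
    "p \<in> Arr E" "Src E p = P" "Tgt E p = A" "q \<in> Arr E" "Src E q = P" "Tgt E q = B"
  using assms unfolding biproduct_via_iff by auto

lemma biproduct_via_eqs:
  assumes "biproduct_via E A B P i j p q"
  shows "p \<cdot> i = Ident E A" "q \<cdot> j = Ident E B" "q \<cdot> i = Null E A B" "p \<cdot> j = Null E B A"
  using assms unfolding biproduct_via_iff by auto

lemma biproduct_via_sum: "biproduct_via E A B P i j p q \<Longrightarrow> Plus E (i \<cdot> p) (j \<cdot> q) = Ident E P"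
  unfolding biproduct_via_iff by auto

lemma biproduct_iso:
  assumes "biproduct E A B P" "isomorphic E A A'" "isomorphic E B B'" "isomorphic E P P'"
  shows "biproduct E A' B' P'"
proof -
  obtain i j p q where Vv: "biproduct_via E A B P i j p q"
    using assms(1) unfolding biproduct_def by blast
  note v = biproduct_via_Arr[OF Vv] and ev = biproduct_via_eqs[OF Vv]
    and sv = biproduct_via_sum[OF Vv]
  obtain a a' where a: "a \<in> Arr E" "Src E a = A" "Tgt E a = A'" "a' \<in> Arr E" "Src E a' = A'" "Tgt E a' = A"
    and aa: "a' \<cdot> a = Ident E A" "a \<cdot> a' = Ident E A'"
    using assms(2) by (rule isomorphicE)
  obtain b b' where b: "b \<in> Arr E" "Src E b = B" "Tgt E b = B'" "b' \<in> Arr E" "Src E b' = B'" "Tgt E b' = B"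
    and bb: "b' \<cdot> b = Ident E B" "b \<cdot> b' = Ident E B'"
    using assms(3) by (rule isomorphicE)
  obtain c c' where c: "c \<in> Arr E" "Src E c = P" "Tgt E c = P'" "c' \<in> Arr E" "Src E c' = P'" "Tgt E c' = P"
    and cc: "c' \<cdot> c = Ident E P" "c \<cdot> c' = Ident E P'"
    using assms(4) by (rule isomorphicE)
  have "Plus E (c \<cdot> (i \<cdot> (p \<cdot> c'))) (c \<cdot> (j \<cdot> (q \<cdot> c'))) = c \<cdot> (Plus E (i \<cdot> p) (j \<cdot> q) \<cdot> c')"
    using v c by (simp add: additive_simps)
  also have "\<dots> = Ident E P'"
    unfolding sv using c cc by (simp add: additive_simps)
  finally have "biproduct_via E A' B' P' (c \<cdot> i \<cdot> a') (c \<cdot> j \<cdot> b') (a \<cdot> p \<cdot> c') (b \<cdot> q \<cdot> c')"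
    unfolding biproduct_via_iff
    using biproduct_Obj[OF assms(1)] isomorphic_Obj[OF assms(2)] isomorphic_Obj[OF assms(3)] v ev a aa b bb c cc
    by (simp add: additive_simps ev[THEN Cmp_Cmp_eq] aa[THEN Cmp_Cmp_eq] bb[THEN Cmp_Cmp_eq]
        cc[THEN Cmp_Cmp_eq])
  then show ?thesis unfolding biproduct_def by blast
qed

lemma biproduct_unique:
  assumes "biproduct E A B P" "biproduct E A B P'"
  shows "isomorphic E P P'"
proof -
  obtain i j p q where Vv: "biproduct_via E A B P i j p q"
    using assms(1) unfolding biproduct_def by blast
  note v = biproduct_via_Arr[OF Vv] and ev = biproduct_via_eqs[OF Vv]
    and sv = biproduct_via_sum[OF Vv]
  obtain i' j' p' q' where Vw: "biproduct_via E A B P' i' j' p' q'"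
    using assms(2) unfolding biproduct_def by blast
  note w = biproduct_via_Arr[OF Vw] and ew = biproduct_via_eqs[OF Vw]
    and sw = biproduct_via_sum[OF Vw]
  note s = additive_simps ev[THEN Cmp_Cmp_eq] ew[THEN Cmp_Cmp_eq]
  show ?thesis
    by (rule isomorphicI[of "Plus E (i' \<cdot> p) (j' \<cdot> q)" _ _ "Plus E (i \<cdot> p') (j \<cdot> q')"])
      (use biproduct_Obj[OF assms(1)] biproduct_Obj[OF assms(2)] v w ev ew sv sw in \<open>simp_all add: s\<close>)
qed

lemma biproduct_assoc:
  assumes "biproduct E A B P" "biproduct E P C Q" "biproduct E B C R"
  shows "biproduct E A R Q"
proof -
  obtain i j p q where Vv: "biproduct_via E A B P i j p q"
    using assms(1) unfolding biproduct_def by blast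
  note v = biproduct_via_Arr[OF Vv] and ev = biproduct_via_eqs[OF Vv]
    and sv = biproduct_via_sum[OF Vv]
  obtain k l r s where Vw: "biproduct_via E P C Q k l r s"
    using assms(2) unfolding biproduct_def by blast
  note w = biproduct_via_Arr[OF Vw] and ew = biproduct_via_eqs[OF Vw]
    and sw = biproduct_via_sum[OF Vw]
  obtain m n u t where Vx: "biproduct_via E B C R m n u t"
    using assms(3) unfolding biproduct_def by blast
  note x = biproduct_via_Arr[OF Vx] and ex = biproduct_via_eqs[OF Vx]
    and sx = biproduct_via_sum[OF Vx]
  note eqs = ev ew ex ev[THEN Cmp_Cmp_eq] ew[THEN Cmp_Cmp_eq] ex[THEN Cmp_Cmp_eq]
  have "Plus E (Plus E (k \<cdot> (i \<cdot> (p \<cdot> r))) (k \<cdot> (j \<cdot> (q \<cdot> r)))) (l \<cdot> s)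
      = Plus E (k \<cdot> (Plus E (i \<cdot> p) (j \<cdot> q) \<cdot> r)) (l \<cdot> s)"
    using v w by (simp add: additive_simps)
  also have "\<dots> = Ident E Q"
    unfolding sv using w sw by (simp add: additive_simps)
  finally have "biproduct_via E A R Q (k \<cdot> i) (Plus E (k \<cdot> j \<cdot> u) (l \<cdot> t)) (p \<cdot> r)
      (Plus E (m \<cdot> q \<cdot> r) (n \<cdot> s))"
    unfolding biproduct_via_iff
    using biproduct_Obj[OF assms(1)] biproduct_Obj[OF assms(2)] biproduct_Obj[OF assms(3)] v w x sx
    by (simp add: additive_simps eqs Plus_assoc)
  then show ?thesis unfolding biproduct_def by blast
qed

lemma zero_object_arrow:
  assumes "zero_object E Z" "f \<in> Arr E" "Src E f = A" "Tgt E f = B" "A = Z \<or> B = Z"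
  shows "f = Null E A B"
proof -
  have *: "f \<in> Hom E A B" "Null E A B \<in> Hom E A B" "A \<in> Obj E" "B \<in> Obj E"
    using assms by (auto simp: Hom_iff additive_simps)
  then show ?thesis using assms(1,5) unfolding zero_object_def by metis
qed

lemma biproduct_zero:
  assumes "zero_object E Z" "A \<in> Obj E"
  shows "biproduct E A Z A"
proof -
  have Z: "Z \<in> Obj E" using assms unfolding zero_object_def by blast
  have "Null E Z Z = Ident E Z"
    using zero_object_arrow[OF assms(1), of "Ident E Z"] Z by (auto simp: arrow_simps)
  then have "biproduct_via E A Z A (Ident E A) (Null E Z A) (Ident E A) (Null E A Z)"
    unfolding biproduct_via_iff using assms Z by (auto simp: additive_simps)
  then show ?thesis unfolding biproduct_def by blast
qed

end

section \<open>Kernels and cokernels\<close>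

context preadditive_category
begin

lemma kernel_Arr:
  assumes "is_kernel E A B C i p"
  shows "i \<in> Arr E" "Src E i = A" "Tgt E i = B" "p \<in> Arr E" "Src E p = B" "Tgt E p = C"
    "p \<cdot> i = Null E A C"
  using assms unfolding is_kernel_def by (auto simp: Hom_iff)

lemma cokernel_Arr:
  assumes "is_cokernel E A B C i p"
  shows "i \<in> Arr E" "Src E i = A" "Tgt E i = B" "p \<in> Arr E" "Src E p = B" "Tgt E p = C"
    "p \<cdot> i = Null E A C"
  using assms unfolding is_cokernel_def by (auto simp: Hom_iff)

lemma kernel_factor:
  assumes "is_kernel E A B C i p" "h \<in> Arr E" "Src E h = T" "Tgt E h = B" "p \<cdot> h = Null E T C"
  shows "\<exists>k\<in>Arr E. Src E k = T \<and> Tgt E k = A \<and> i \<cdot> k = h"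
proof -
  have "T \<in> Obj E" "h \<in> Hom E T B" using assms(2-4) by (auto simp: Hom_iff Src_in_Obj)
  then have "\<exists>!k. k \<in> Hom E T A \<and> i \<cdot> k = h" using assms(1,5) unfolding is_kernel_def by blast
  then show ?thesis by (auto simp: Hom_iff)
qed

lemma cokernel_factor:
  assumes "is_cokernel E A B C i p" "h \<in> Arr E" "Src E h = B" "Tgt E h = T" "h \<cdot> i = Null E A T"
  shows "\<exists>k\<in>Arr E. Src E k = C \<and> Tgt E k = T \<and> k \<cdot> p = h"
proof -
  have "T \<in> Obj E" "h \<in> Hom E B T" using assms(2-4) by (auto simp: Hom_iff Tgt_in_Obj)
  then have "\<exists>!k. k \<in> Hom E C T \<and> k \<cdot> p = h" using assms(1,5) unfolding is_cokernel_def by blast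
  then show ?thesis by (auto simp: Hom_iff)
qed

lemma kernel_cancel:
  assumes "is_kernel E A B C i p" "k \<in> Arr E" "Src E k = T" "Tgt E k = A"
    "k' \<in> Arr E" "Src E k' = T" "Tgt E k' = A" "i \<cdot> k = i \<cdot> k'"
  shows "k = k'"
proof -
  note K = kernel_Arr[OF assms(1)]
  have "C \<in> Obj E" using K by (auto simp: Tgt_in_Obj)
  then have "p \<cdot> (i \<cdot> k) = Null E T C"
    using K assms(2-7) by (simp add: Cmp_Cmp_eq[OF K(7)] additive_simps)
  moreover have "T \<in> Obj E" "i \<cdot> k \<in> Hom E T B" "k \<in> Hom E T A" "k' \<in> Hom E T A"
    using K assms(2-7) by (auto simp: Hom_iff arrow_simps)
  moreover from this have "\<exists>!m. m \<in> Hom E T A \<and> i \<cdot> m = i \<cdot> k"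
    using assms(1) calculation(1) unfolding is_kernel_def by blast
  ultimately show ?thesis using assms(8) by metis
qed

lemma cokernel_cancel:
  assumes "is_cokernel E A B C i p" "k \<in> Arr E" "Src E k = C" "Tgt E k = T"
    "k' \<in> Arr E" "Src E k' = C" "Tgt E k' = T" "k \<cdot> p = k' \<cdot> p"
  shows "k = k'"
proof -
  note K = cokernel_Arr[OF assms(1)]
  have "A \<in> Obj E" using K by (auto simp: Src_in_Obj)
  then have "(k \<cdot> p) \<cdot> i = Null E A T"
    using K assms(2-7) by (simp add: additive_simps)
  moreover have "T \<in> Obj E" "k \<cdot> p \<in> Hom E B T" "k \<in> Hom E C T" "k' \<in> Hom E C T"
    using K assms(2-7) by (auto simp: Hom_iff arrow_simps)
  moreover from this have "\<exists>!m. m \<in> Hom E C T \<and> m \<cdot> p = k \<cdot> p"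
    using assms(1) calculation(1) unfolding is_cokernel_def by blast
  ultimately show ?thesis using assms(8) by metis
qed

lemma kernelI:
  assumes "i \<in> Arr E" "Src E i = A" "Tgt E i = B" "p \<in> Arr E" "Src E p = B" "Tgt E p = C"
    "p \<cdot> i = Null E A C"
    and "\<And>T h. \<lbrakk>T \<in> Obj E; h \<in> Arr E; Src E h = T; Tgt E h = B; p \<cdot> h = Null E T C\<rbrakk>
      \<Longrightarrow> \<exists>k\<in>Arr E. Src E k = T \<and> Tgt E k = A \<and> i \<cdot> k = h"
    and "\<And>T k k'. \<lbrakk>T \<in> Obj E; k \<in> Arr E; Src E k = T; Tgt E k = A; k' \<in> Arr E; Src E k' = T; Tgt E k' = A;
      i \<cdot> k = i \<cdot> k'\<rbrakk> \<Longrightarrow> k = k'"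
  shows "is_kernel E A B C i p"
proof -
  have "\<exists>!k. k \<in> Hom E T A \<and> i \<cdot> k = h"
    if "T \<in> Obj E" "h \<in> Hom E T B" "p \<cdot> h = Null E T C" for T h
  proof (rule ex_ex1I)
    show "\<exists>k. k \<in> Hom E T A \<and> i \<cdot> k = h" using assms(8)[of T h] that by (auto simp: Hom_iff)
  next
    fix k k' assume "k \<in> Hom E T A \<and> i \<cdot> k = h" "k' \<in> Hom E T A \<and> i \<cdot> k' = h"
    then show "k = k'" using assms(9)[of T k k'] that(1) by (auto simp: Hom_iff)
  qed
  moreover have "i \<in> Hom E A B" "p \<in> Hom E B C" using assms(1-6) by (auto simp: Hom_iff)
  ultimately show ?thesis using assms(7) unfolding is_kernel_def by blast
qed

lemma cokernelI:
  assumes "i \<in> Arr E" "Src E i = A" "Tgt E i = B" "p \<in> Arr E" "Src E p = B" "Tgt E p = C"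
    "p \<cdot> i = Null E A C"
    and "\<And>T h. \<lbrakk>T \<in> Obj E; h \<in> Arr E; Src E h = B; Tgt E h = T; h \<cdot> i = Null E A T\<rbrakk>
      \<Longrightarrow> \<exists>k\<in>Arr E. Src E k = C \<and> Tgt E k = T \<and> k \<cdot> p = h"
    and "\<And>T k k'. \<lbrakk>T \<in> Obj E; k \<in> Arr E; Src E k = C; Tgt E k = T; k' \<in> Arr E; Src E k' = C; Tgt E k' = T;
      k \<cdot> p = k' \<cdot> p\<rbrakk> \<Longrightarrow> k = k'"
  shows "is_cokernel E A B C i p"
proof -
  have "\<exists>!k. k \<in> Hom E C T \<and> k \<cdot> p = h"
    if "T \<in> Obj E" "h \<in> Hom E B T" "h \<cdot> i = Null E A T" for T h
  proof (rule ex_ex1I)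
    show "\<exists>k. k \<in> Hom E C T \<and> k \<cdot> p = h" using assms(8)[of T h] that by (auto simp: Hom_iff)
  next
    fix k k' assume "k \<in> Hom E C T \<and> k \<cdot> p = h" "k' \<in> Hom E C T \<and> k' \<cdot> p = h"
    then show "k = k'" using assms(9)[of T k k'] that(1) by (auto simp: Hom_iff)
  qed
  moreover have "i \<in> Hom E A B" "p \<in> Hom E B C" using assms(1-6) by (auto simp: Hom_iff)
  ultimately show ?thesis using assms(7) unfolding is_cokernel_def by blast
qed

lemma iso_arrowI:
  assumes "f \<in> Arr E" "Src E f = A" "Tgt E f = B" "g \<in> Arr E" "Src E g = B" "Tgt E g = A"
    "g \<cdot> f = Ident E A" "f \<cdot> g = Ident E B"
  shows "iso_arrow E A B f"
  unfolding iso_arrow_def by (intro conjI bexI[of _ g]) (use assms in \<open>simp_all add: Hom_iff\<close>)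

lemma kernel_unique:
  assumes "is_kernel E A B C i p" "is_kernel E A' B C i' p"
  shows "\<exists>a. iso_arrow E A A' a \<and> i' \<cdot> a = i"
proof -
  note K = kernel_Arr[OF assms(1)] and K' = kernel_Arr[OF assms(2)]
  obtain a where a: "a \<in> Arr E" "Src E a = A" "Tgt E a = A'" "i' \<cdot> a = i"
    using kernel_factor[OF assms(2) K(1-3,7)] by blast
  obtain b where b: "b \<in> Arr E" "Src E b = A'" "Tgt E b = A" "i \<cdot> b = i'"
    using kernel_factor[OF assms(1) K'(1-3,7)] by blast
  have obj: "A \<in> Obj E" "A' \<in> Obj E" using K K' Src_in_Obj by auto
  have "b \<cdot> a = Ident E A"
    by (rule kernel_cancel[OF assms(1)])
      (use K a b obj in \<open>simp_all add: arrow_simps Cmp_Cmp_eq[OF b(4)]\<close>)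
  moreover have "a \<cdot> b = Ident E A'"
    by (rule kernel_cancel[OF assms(2)])
      (use K' a b obj in \<open>simp_all add: arrow_simps Cmp_Cmp_eq[OF a(4)]\<close>)
  ultimately have "iso_arrow E A A' a" using a b by (intro iso_arrowI[of a _ _ b])
  then show ?thesis using a(4) by blast
qed

lemma cokernel_unique:
  assumes "is_cokernel E A B C i p" "is_cokernel E A B C' i p'"
  shows "\<exists>c. iso_arrow E C C' c \<and> c \<cdot> p = p'"
proof -
  note K = cokernel_Arr[OF assms(1)] and K' = cokernel_Arr[OF assms(2)]
  obtain a where a: "a \<in> Arr E" "Src E a = C" "Tgt E a = C'" "a \<cdot> p = p'"
    using cokernel_factor[OF assms(1) K'(4-7)] by blast
  obtain b where b: "b \<in> Arr E" "Src E b = C'" "Tgt E b = C" "b \<cdot> p' = p"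
    using cokernel_factor[OF assms(2) K(4-7)] by blast
  have obj: "C \<in> Obj E" "C' \<in> Obj E" using K K' Tgt_in_Obj by auto
  have "b \<cdot> a = Ident E C"
    by (rule cokernel_cancel[OF assms(1)])
      (use K a b obj in \<open>simp_all add: arrow_simps\<close>)
  moreover have "a \<cdot> b = Ident E C'"
    by (rule cokernel_cancel[OF assms(2)])
      (use K' a b obj in \<open>simp_all add: arrow_simps\<close>)
  ultimately have "iso_arrow E C C' a" using a b by (intro iso_arrowI[of a _ _ b])
  then show ?thesis using a(4) by blast
qed

lemma iso_arrow_Ident: "A \<in> Obj E \<Longrightarrow> iso_arrow E A A (Ident E A)"
  by (rule iso_arrowI[of _ _ _ "Ident E A"]) (simp_all add: arrow_simps)

lemma biproduct_cokernel:
  assumes "biproduct_via E A B P i j p q"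
  shows "is_cokernel E A P B i q"
proof -
  note v = biproduct_via_Arr[OF assms] and ev = biproduct_via_eqs[OF assms]
    and sv = biproduct_via_sum[OF assms]
  have obj: "A \<in> Obj E" "B \<in> Obj E" "P \<in> Obj E" using assms biproduct_Obj unfolding biproduct_def by blast+
  show ?thesis
  proof (rule cokernelI)
    fix T h assume h: "T \<in> Obj E" "h \<in> Arr E" "Src E h = P" "Tgt E h = T" "h \<cdot> i = Null E A T"
    have "h = h \<cdot> Plus E (i \<cdot> p) (j \<cdot> q)" unfolding sv using h by (simp add: arrow_simps)
    also have "\<dots> = (h \<cdot> j) \<cdot> q"
      using v h obj by (simp add: additive_simps h(5)[THEN Cmp_Cmp_eq])
    finally show "\<exists>k\<in>Arr E. Src E k = B \<and> Tgt E k = T \<and> k \<cdot> q = h"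
      using v h by (intro bexI[of _ "h \<cdot> j"]) (auto simp: arrow_simps)
  next
    fix T k k' assume k: "T \<in> Obj E" "k \<in> Arr E" "Src E k = B" "Tgt E k = T" "k' \<in> Arr E"
      "Src E k' = B" "Tgt E k' = T" "k \<cdot> q = k' \<cdot> q"
    have "k = (k \<cdot> q) \<cdot> j" using v k(1-7) ev by (simp add: arrow_simps)
    also have "\<dots> = (k' \<cdot> q) \<cdot> j" using k(8) by simp
    also have "\<dots> = k'" using v k(1-7) ev by (simp add: arrow_simps)
    finally show "k = k'" .
  qed (use v ev in auto)
qed

end

section \<open>Short exact sequences from biproducts\<close>

context exact_category
begin

lemma sesE:
  assumes "ses E A B C"
  obtains i p where "(i, p) \<in> Confl E" "is_kernel E A B C i p" "is_cokernel E A B C i p"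
proof -
  obtain i p where ip: "(i, p) \<in> Confl E" "i \<in> Hom E A B" "p \<in> Hom E B C"
    using assms unfolding ses_def by blast
  moreover have "is_kernel E A B C i p \<and> is_cokernel E A B C i p"
    using Confl_kernel_cokernel[OF ip(1)] ip(2,3) unfolding is_kernel_def Hom_iff by metis
  ultimately show thesis using that by blast
qed

lemma ses_Obj:
  assumes "ses E A B C"
  shows "A \<in> Obj E" "B \<in> Obj E" "C \<in> Obj E"
  using assms Src_in_Obj Tgt_in_Obj unfolding ses_def Hom_iff by blast+

text \<open>Membership in \<open>Confl\<close> is a property of either arrow alone: cokernels are unique up to a unique
  isomorphism, and \<open>Confl\<close> is closed under isomorphism of sequences.\<close>
lemma adm_mono_cokernel:
  assumes "adm_mono E i" "is_cokernel E A B C i p"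
  shows "(i, p) \<in> Confl E"
proof -
  obtain q A0 B0 C0 where q: "(i, q) \<in> Confl E" "is_kernel E A0 B0 C0 i q" "is_cokernel E A0 B0 C0 i q"
    using assms(1) Confl_kernel_cokernel unfolding adm_mono_def by blast
  note K = cokernel_Arr[OF q(3)] and K' = cokernel_Arr[OF assms(2)]
  have [simp]: "A0 = A" "B0 = B" using K K' by auto
  obtain c where c: "iso_arrow E C0 C c" "c \<cdot> q = p"
    using cokernel_unique[of A B C0 i q C p] q assms by auto
  have obj: "A \<in> Obj E" "B \<in> Obj E" using K' by (auto simp: arrow_simps)
  show ?thesis
    by (rule Confl_iso_closed[OF q(1), where A=A and B=B and C=C0 and A'=A and B'=B and C'=C
        and a="Ident E A" and b="Ident E B" and c="c"])
      (use K K' c obj in \<open>simp_all add: Hom_iff arrow_simps iso_arrow_Ident\<close>)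
qed

lemma adm_epi_kernel:
  assumes "adm_epi E p" "is_kernel E A B C i p"
  shows "(i, p) \<in> Confl E"
proof -
  obtain k A0 B0 C0 where q: "(k, p) \<in> Confl E" "is_kernel E A0 B0 C0 k p" "is_cokernel E A0 B0 C0 k p"
    using assms(1) Confl_kernel_cokernel unfolding adm_epi_def by blast
  note K = kernel_Arr[OF q(2)] and K' = kernel_Arr[OF assms(2)]
  have [simp]: "C0 = C" "B0 = B" using K K' by auto
  obtain a where a: "iso_arrow E A0 A a" "i \<cdot> a = k"
    using kernel_unique[of A0 B C k p A i] q assms by auto
  have obj: "C \<in> Obj E" "B \<in> Obj E" using K' by (auto simp: arrow_simps)
  show ?thesis
    by (rule Confl_iso_closed[OF q(1), where A=A0 and B=B and C=C and A'=A and B'=B and C'=C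
        and a="a" and b="Ident E B" and c="Ident E C"])
      (use K K' a obj in \<open>simp_all add: Hom_iff arrow_simps iso_arrow_Ident\<close>)
qed

text \<open>The kernel of the identity of \<open>B\<close> is an admissible monomorphism that is a zero arrow. The pushout of
  zero arrows is a coproduct, so the pushout along the zero arrow to \<open>A\<close> is the biproduct, and the axiom on
  pushouts makes the injection of \<open>A\<close> admissible.\<close>
lemma biproduct_Confl:
  assumes "biproduct_via E A B P i j p q"
  shows "(i, q) \<in> Confl E"
proof -
  note v = biproduct_via_Arr[OF assms] and ev = biproduct_via_eqs[OF assms]
    and sv = biproduct_via_sum[OF assms]
  have obj: "A \<in> Obj E" "B \<in> Obj E" "P \<in> Obj E" using assms biproduct_Obj unfolding biproduct_def by blast+
  obtain n A0 B0 C0 where n: "(n, Ident E B) \<in> Confl E" "is_kernel E A0 B0 C0 n (Ident E B)"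
    using adm_epi_Ident[OF obj(2)] Confl_kernel_cokernel unfolding adm_epi_def by blast
  note N = kernel_Arr[OF n(2)]
  have [simp]: "B0 = B" "C0 = B" using N obj by (auto simp: arrow_simps)
  have obj0: "A0 \<in> Obj E" using Src_in_Obj[OF N(1)] N(2) by simp
  have n0: "n = Null E A0 B" using N obj by (auto simp: arrow_simps)
  have mono_n: "adm_mono E n" using n(1) unfolding adm_mono_def by blast
  obtain P' i' f' where po: "is_pushout E A0 B A P' n (Null E A0 A) i' f'" and mono: "adm_mono E i'"
    using adm_mono_pushout[OF mono_n, of A0 B "Null E A0 A" A] N obj obj0
    by (auto simp: Hom_iff additive_simps)
  have po': "i' \<in> Arr E" "Src E i' = A" "Tgt E i' = P'" "f' \<in> Arr E" "Src E f' = B" "Tgt E f' = P'"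
    using po unfolding is_pushout_def Hom_iff by auto
  have univ: "\<exists>!k. k \<in> Hom E P' T \<and> k \<cdot> i' = u \<and> k \<cdot> f' = w"
    if "u \<in> Hom E A T" "w \<in> Hom E B T" for T u w
  proof -
    have "T \<in> Obj E" "u \<cdot> Null E A0 A = w \<cdot> n"
      using that obj obj0 by (auto simp: n0 Hom_iff additive_simps)
    then show ?thesis using po that unfolding is_pushout_def by blast
  qed
  obtain k where k: "k \<in> Arr E" "Src E k = P'" "Tgt E k = P" "k \<cdot> i' = i" "k \<cdot> f' = j"
    using univ[of i P j] v by (auto simp: Hom_iff)
  \<comment> \<open>the pushout map and the map assembled from the projections are inverse to each other\<close>
  define l where "l = Plus E (i' \<cdot> p) (f' \<cdot> q)"
  have l: "l \<in> Arr E" "Src E l = P" "Tgt E l = P'"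
    unfolding l_def using v po' by (auto simp: additive_simps)
  have kl: "k \<cdot> l = Ident E P"
    unfolding l_def using v po' k sv
    by (simp add: additive_simps k(4,5)[THEN Cmp_Cmp_eq])
  have objP': "P' \<in> Obj E" using po' by (auto simp: arrow_simps)
  have "l \<cdot> i = i'" "l \<cdot> j = f'"
    unfolding l_def using v ev po' obj objP' by (auto simp: additive_simps)
  then have "(l \<cdot> k) \<cdot> i' = i'" "(l \<cdot> k) \<cdot> f' = f'"
    using k l po' by (simp_all add: arrow_simps)
  then have "l \<cdot> k \<in> Hom E P' P' \<and> (l \<cdot> k) \<cdot> i' = i' \<and> (l \<cdot> k) \<cdot> f' = f'"
    using k l by (simp add: Hom_iff arrow_simps)
  moreover have "Ident E P' \<in> Hom E P' P' \<and> Ident E P' \<cdot> i' = i' \<and> Ident E P' \<cdot> f' = f'"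
    using po' objP' by (simp add: Hom_iff arrow_simps)
  moreover have "i' \<in> Hom E A P'" "f' \<in> Hom E B P'" using po' by (simp_all add: Hom_iff)
  ultimately have lk: "l \<cdot> k = Ident E P'" using univ[of i' P' f'] by blast
  obtain r A1 B1 C1 where r: "(i', r) \<in> Confl E" "is_cokernel E A1 B1 C1 i' r"
    using mono Confl_kernel_cokernel unfolding adm_mono_def by blast
  note R = cokernel_Arr[OF r(2)]
  have [simp]: "A1 = A" "B1 = P'" using R po' by auto
  have objC: "C1 \<in> Obj E" using Tgt_in_Obj[OF R(4)] R(6) by simp
  have iso: "iso_arrow E P' P k" using k l kl lk by (intro iso_arrowI[of k _ _ l])
  have "(i, r \<cdot> l) \<in> Confl E"
    by (rule Confl_iso_closed[OF r(1), where A=A and B="P'" and C=C1 and A'=A and B'=P and C'=C1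
        and a="Ident E A" and b="k" and c="Ident E C1"])
      (use R v k l lk obj objC iso in \<open>simp_all add: Hom_iff arrow_simps iso_arrow_Ident\<close>)
  then have "adm_mono E i" unfolding adm_mono_def by blast
  then show ?thesis using biproduct_cokernel[OF assms] by (rule adm_mono_cokernel)
qed

lemma sesI:
  assumes "(i, p) \<in> Confl E" "i \<in> Arr E" "Src E i = A" "Tgt E i = B" "p \<in> Arr E" "Src E p = B" "Tgt E p = C"
  shows "ses E A B C"
proof -
  have "i \<in> Hom E A B" "p \<in> Hom E B C" using assms by (simp_all add: Hom_iff)
  then show ?thesis using assms(1) unfolding ses_def by blast
qed

lemma ses_biproduct: "biproduct E A B P \<Longrightarrow> ses E A P B"
  unfolding ses_def biproduct_def
  using biproduct_Confl biproduct_via_def by metis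

text \<open>The composite of the projection \<open>B \<oplus> D \<rightarrow> B\<close> with the epimorphism \<open>B \<rightarrow> C\<close> is admissible, and its kernel
  is \<open>A \<oplus> D\<close>.\<close>
lemma ses_add_left:
  assumes "ses E A B C" "biproduct E A D P" "biproduct E B D Q"
  shows "ses E P Q C"
proof -
  obtain i p where ip: "(i, p) \<in> Confl E" "is_kernel E A B C i p" using assms(1) by (rule sesE)
  note K = kernel_Arr[OF ip(2)]
  obtain a d a' d' where v: "biproduct_via E A D P a d a' d'"
    using assms(2) unfolding biproduct_def by blast
  obtain b e b' e' where w: "biproduct_via E B D Q b e b' e'"
    using assms(3) unfolding biproduct_def by blast
  have "adm_epi E b'" using biproduct_Confl[OF biproduct_via_sym[OF w]] unfolding adm_epi_def by blast
  moreover have "adm_epi E p" using ip(1) unfolding adm_epi_def by blast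
  moreover note ev = biproduct_via_eqs[OF v] and sv = biproduct_via_sum[OF v]
    and ew = biproduct_via_eqs[OF w] and sw = biproduct_via_sum[OF w]
    and v = biproduct_via_Arr[OF v] and w = biproduct_via_Arr[OF w]
  ultimately have epi: "adm_epi E (p \<cdot> b')"
    using adm_epi_Cmp[of b' p Q B C] K by (auto simp: Hom_iff)
  have obj: "A \<in> Obj E" "B \<in> Obj E" "C \<in> Obj E" "D \<in> Obj E" "P \<in> Obj E" "Q \<in> Obj E"
    using assms ses_Obj biproduct_Obj by auto
  note s = additive_simps ev ew K(7) ev[THEN Cmp_Cmp_eq] ew[THEN Cmp_Cmp_eq] Cmp_Cmp_eq[OF K(7)]
  \<comment> \<open>the direct sum of \<open>i\<close> and the identity of \<open>D\<close>\<close>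
  define k where "k = Plus E (b \<cdot> i \<cdot> a') (e \<cdot> d')"
  have k: "k \<in> Arr E" "Src E k = P" "Tgt E k = Q" unfolding k_def using K v w by (auto simp: s)
  have bk: "b' \<cdot> k = i \<cdot> a'" "e' \<cdot> k = d'"
    unfolding k_def using K v w obj by (auto simp: s)
  have "is_kernel E P Q C k (p \<cdot> b')"
  proof (rule kernelI)
    show "(p \<cdot> b') \<cdot> k = Null E P C" using K v w k bk obj by (simp add: s)
  next
    fix T h assume h: "T \<in> Obj E" "h \<in> Arr E" "Src E h = T" "Tgt E h = Q" "p \<cdot> b' \<cdot> h = Null E T C"
    then obtain u where u: "u \<in> Arr E" "Src E u = T" "Tgt E u = A" "i \<cdot> u = b' \<cdot> h"
      using kernel_factor[OF ip(2), of "b' \<cdot> h" T] K w by (auto simp: arrow_simps)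
    define t where "t = Plus E (a \<cdot> u) (d \<cdot> (e' \<cdot> h))"
    have t: "t \<in> Arr E" "Src E t = T" "Tgt E t = P" unfolding t_def using u v w h by (auto simp: s)
    have at: "a' \<cdot> t = u" "d' \<cdot> t = e' \<cdot> h"
      unfolding t_def using u v w h obj by (simp_all add: s)
    have "k \<cdot> t = Plus E (b \<cdot> (b' \<cdot> h)) (e \<cdot> (e' \<cdot> h))"
      unfolding k_def using K t v w u h by (simp add: s at)
    also have "\<dots> = Plus E (b \<cdot> b') (e \<cdot> e') \<cdot> h" using w h(1-4) by (simp add: s)
    also have "\<dots> = h" unfolding sw using h by (simp add: s)
    finally show "\<exists>t\<in>Arr E. Src E t = T \<and> Tgt E t = P \<and> k \<cdot> t = h" using t by blast
  next
    fix T t t' assume t: "T \<in> Obj E" "t \<in> Arr E" "Src E t = T" "Tgt E t = P"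
      "t' \<in> Arr E" "Src E t' = T" "Tgt E t' = P" "k \<cdot> t = k \<cdot> t'"
    have "i \<cdot> (a' \<cdot> t) = b' \<cdot> (k \<cdot> t)" "i \<cdot> (a' \<cdot> t') = b' \<cdot> (k \<cdot> t')"
      "d' \<cdot> t = e' \<cdot> (k \<cdot> t)" "d' \<cdot> t' = e' \<cdot> (k \<cdot> t')"
      using t(1-7) K v w k by (simp_all add: bk[THEN Cmp_Cmp_eq] s)
    then have eq: "i \<cdot> (a' \<cdot> t) = i \<cdot> (a' \<cdot> t')" "d' \<cdot> t = d' \<cdot> t'" using t(8) by auto
    have eq1: "a' \<cdot> t = a' \<cdot> t'"
      by (rule kernel_cancel[OF ip(2) _ _ _ _ _ _ eq(1)]) (use t v in \<open>auto simp: s\<close>)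
    have "t = Plus E (a \<cdot> a') (d \<cdot> d') \<cdot> t" unfolding sv using t by (simp add: s)
    also have "\<dots> = Plus E (a \<cdot> a') (d \<cdot> d') \<cdot> t'" using t(1-7) v by (simp add: s eq eq1)
    also have "\<dots> = t'" unfolding sv using t by (simp add: s)
    finally show "t = t'" .
  qed (use K v w k in \<open>auto simp: s\<close>)
  then have "(k, p \<cdot> b') \<in> Confl E" using epi adm_epi_kernel by blast
  then show ?thesis by (rule sesI) (use K v w k in \<open>simp_all add: s\<close>)
qed

text \<open>Dually, the composite of \<open>A \<rightarrow> B\<close> with the injection \<open>B \<rightarrow> B \<oplus> D\<close> is admissible with cokernel
  \<open>C \<oplus> D\<close>.\<close>
lemma ses_add_right:
  assumes "ses E A B C" "biproduct E B D Q" "biproduct E C D R"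
  shows "ses E A Q R"
proof -
  obtain i p where ip: "(i, p) \<in> Confl E" "is_cokernel E A B C i p" using assms(1) by (rule sesE)
  note K = cokernel_Arr[OF ip(2)]
  obtain b e b' e' where v: "biproduct_via E B D Q b e b' e'"
    using assms(2) unfolding biproduct_def by blast
  obtain c d c' d' where w: "biproduct_via E C D R c d c' d'"
    using assms(3) unfolding biproduct_def by blast
  have "adm_mono E b" using biproduct_Confl[OF v] unfolding adm_mono_def by blast
  moreover have "adm_mono E i" using ip(1) unfolding adm_mono_def by blast
  moreover note ev = biproduct_via_eqs[OF v] and sv = biproduct_via_sum[OF v]
    and ew = biproduct_via_eqs[OF w] and sw = biproduct_via_sum[OF w]
    and v = biproduct_via_Arr[OF v] and w = biproduct_via_Arr[OF w]
  ultimately have mono: "adm_mono E (b \<cdot> i)"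
    using adm_mono_Cmp[of i b A B Q] K by (auto simp: Hom_iff)
  have obj: "A \<in> Obj E" "B \<in> Obj E" "C \<in> Obj E" "D \<in> Obj E" "Q \<in> Obj E" "R \<in> Obj E"
    using assms ses_Obj biproduct_Obj by auto
  note s = additive_simps ev ew K(7) ev[THEN Cmp_Cmp_eq] ew[THEN Cmp_Cmp_eq] Cmp_Cmp_eq[OF K(7)]
  \<comment> \<open>the direct sum of \<open>p\<close> and the identity of \<open>D\<close>\<close>
  define k where "k = Plus E (c \<cdot> p \<cdot> b') (d \<cdot> e')"
  have k: "k \<in> Arr E" "Src E k = Q" "Tgt E k = R" unfolding k_def using K v w by (auto simp: s)
  have kb: "k \<cdot> b = c \<cdot> p" "k \<cdot> e = d"
    unfolding k_def using K v w obj by (auto simp: s)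
  have "is_cokernel E A Q R (b \<cdot> i) k"
  proof (rule cokernelI)
    show "k \<cdot> (b \<cdot> i) = Null E A R" using K v w k obj by (simp add: kb[THEN Cmp_Cmp_eq] s)
  next
    fix T h assume h: "T \<in> Obj E" "h \<in> Arr E" "Src E h = Q" "Tgt E h = T" "h \<cdot> (b \<cdot> i) = Null E A T"
    then obtain u where u: "u \<in> Arr E" "Src E u = C" "Tgt E u = T" "u \<cdot> p = h \<cdot> b"
      using cokernel_factor[OF ip(2), of "h \<cdot> b" T] K v by (auto simp: arrow_simps)
    define t where "t = Plus E (u \<cdot> c') (h \<cdot> e \<cdot> d')"
    have t: "t \<in> Arr E" "Src E t = R" "Tgt E t = T" unfolding t_def using u v w h by (auto simp: s)
    have tc: "t \<cdot> c = u" "t \<cdot> d = h \<cdot> e"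
      unfolding t_def using u v w h obj by (simp_all add: s)
    have "t \<cdot> k = Plus E ((h \<cdot> b) \<cdot> b') ((h \<cdot> e) \<cdot> e')"
      unfolding k_def using K t u h v w by (simp add: s tc[THEN Cmp_Cmp_eq] u(4)[THEN Cmp_Cmp_eq])
    also have "\<dots> = h \<cdot> Plus E (b \<cdot> b') (e \<cdot> e')" using v h(1-4) by (simp add: s)
    also have "\<dots> = h" unfolding sv using h by (simp add: s)
    finally show "\<exists>t\<in>Arr E. Src E t = R \<and> Tgt E t = T \<and> t \<cdot> k = h" using t by blast
  next
    fix T t t' assume t: "T \<in> Obj E" "t \<in> Arr E" "Src E t = R" "Tgt E t = T"
      "t' \<in> Arr E" "Src E t' = R" "Tgt E t' = T" "t \<cdot> k = t' \<cdot> k"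
    have "(t \<cdot> c) \<cdot> p = (t \<cdot> k) \<cdot> b" "(t' \<cdot> c) \<cdot> p = (t' \<cdot> k) \<cdot> b"
      "t \<cdot> d = (t \<cdot> k) \<cdot> e" "t' \<cdot> d = (t' \<cdot> k) \<cdot> e"
      using t(1-7) K v w k by (simp_all add: kb s)
    then have eq: "(t \<cdot> c) \<cdot> p = (t' \<cdot> c) \<cdot> p" "t \<cdot> d = t' \<cdot> d" using t(8) by auto
    have eq1: "t \<cdot> c = t' \<cdot> c"
      by (rule cokernel_cancel[OF ip(2) _ _ _ _ _ _ eq(1)]) (use t w in \<open>auto simp: s\<close>)
    have "t = t \<cdot> Plus E (c \<cdot> c') (d \<cdot> d')" unfolding sw using t by (simp add: s)
    also have "\<dots> = Plus E ((t \<cdot> c) \<cdot> c') ((t \<cdot> d) \<cdot> d')" using t(1-7) w by (simp add: s)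
    also have "\<dots> = t' \<cdot> Plus E (c \<cdot> c') (d \<cdot> d')" unfolding eq eq1 using t(1-7) w by (simp add: s)
    also have "\<dots> = t'" unfolding sw using t by (simp add: s)
    finally show "t = t'" .
  qed (use K v w k in \<open>auto simp: s\<close>)
  then have "(b \<cdot> i, k) \<in> Confl E" using mono adm_mono_cokernel by blast
  then show ?thesis by (rule sesI) (use K v w k in \<open>simp_all add: s\<close>)
qed

end

section \<open>The commutative monoid of isomorphism classes\<close>

text \<open>The choice of a biproduct and of a zero object is immaterial, because both are unique up to
  isomorphism.\<close>
definition iso_monoid :: "('o, 'm, 'z) preadditive_data_scheme \<Rightarrow> 'o set monoid" where
  "iso_monoid E = \<lparr>carrier = iso_class E ` Obj E,
     monoid.mult = (\<lambda>U V. iso_class E (SOME P. \<exists>A\<in>U. \<exists>B\<in>V. biproduct E A B P)),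
     one = iso_class E (SOME Z. zero_object E Z)\<rparr>"

lemma carrier_iso_monoid: "carrier (iso_monoid E) = iso_class E ` Obj E"
  by (simp add: iso_monoid_def)

context additive_category
begin

lemma iso_monoid_mult:
  assumes "biproduct E A B P"
  shows "iso_class E A \<otimes>\<^bsub>iso_monoid E\<^esub> iso_class E B = iso_class E P"
proof -
  have "\<exists>A'\<in>iso_class E A. \<exists>B'\<in>iso_class E B. biproduct E A' B' P"
    using assms biproduct_Obj isomorphic_refl unfolding iso_class_def by blast
  then have "\<exists>A'\<in>iso_class E A. \<exists>B'\<in>iso_class E B.
      biproduct E A' B' (SOME P. \<exists>A\<in>iso_class E A. \<exists>B\<in>iso_class E B. biproduct E A B P)"
    (is "\<exists>A'\<in>_. \<exists>B'\<in>_. biproduct E A' B' ?P") by (rule someI)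
  then obtain A' B' where AB: "isomorphic E A A'" "isomorphic E B B'" "biproduct E A' B' ?P"
    unfolding iso_class_def by blast
  have "biproduct E A' B' P"
    using biproduct_iso[OF assms AB(1,2)] isomorphic_refl biproduct_Obj[OF assms] by blast
  then have "isomorphic E ?P P" using AB(3) biproduct_unique by blast
  then show ?thesis
    using iso_class_eq_iff isomorphic_Obj by (simp add: iso_monoid_def)
qed

lemma iso_monoid_one:
  assumes "zero_object E Z"
  shows "\<one>\<^bsub>iso_monoid E\<^esub> = iso_class E Z"
proof -
  define Z' where "Z' = (SOME Z. zero_object E Z)"
  have Z': "zero_object E Z'" unfolding Z'_def using assms by (rule someI)
  have "Z \<in> Obj E" "Z' \<in> Obj E" using assms Z' unfolding zero_object_def by auto
  then have "biproduct E Z Z' Z" "biproduct E Z' Z Z'"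
    using biproduct_zero assms Z' by auto
  then have "isomorphic E Z Z'" using biproduct_sym biproduct_unique by blast
  then have "iso_class E Z = iso_class E Z'" using iso_class_eq_iff isomorphic_Obj by blast
  then show ?thesis unfolding iso_monoid_def Z'_def by simp
qed

lemma comm_monoid_iso_monoid: "comm_monoid (iso_monoid E)"
proof (rule comm_monoidI)
  obtain Z where Z: "zero_object E Z" using ex_zero_object by blast
  then have ZO: "Z \<in> Obj E" unfolding zero_object_def by blast
  note carr = carrier_iso_monoid[of E]
  show "\<one>\<^bsub>iso_monoid E\<^esub> \<in> carrier (iso_monoid E)" using Z ZO by (simp add: carr iso_monoid_one)
  fix x assume "x \<in> carrier (iso_monoid E)"
  then obtain A where A: "A \<in> Obj E" "x = iso_class E A" unfolding carr by blast
  show "\<one>\<^bsub>iso_monoid E\<^esub> \<otimes>\<^bsub>iso_monoid E\<^esub> x = x"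
    using iso_monoid_mult[OF biproduct_sym[OF biproduct_zero[OF Z A(1)]]] A iso_monoid_one[OF Z] by simp
  fix y assume "y \<in> carrier (iso_monoid E)"
  then obtain B where B: "B \<in> Obj E" "y = iso_class E B" unfolding carr by blast
  obtain P where P: "P \<in> Obj E" "biproduct E A B P" using ex_biproduct A B by blast
  show "x \<otimes>\<^bsub>iso_monoid E\<^esub> y \<in> carrier (iso_monoid E)"
    using A B P iso_monoid_mult by (simp add: carr)
  show "x \<otimes>\<^bsub>iso_monoid E\<^esub> y = y \<otimes>\<^bsub>iso_monoid E\<^esub> x"
    using A B P iso_monoid_mult biproduct_sym by metis
  fix z assume "z \<in> carrier (iso_monoid E)"
  then obtain C where C: "C \<in> Obj E" "z = iso_class E C" unfolding carr by blast
  obtain R where R: "R \<in> Obj E" "biproduct E B C R" using ex_biproduct B C by blast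
  obtain Q where Q: "Q \<in> Obj E" "biproduct E P C Q" using ex_biproduct P C by blast
  show "x \<otimes>\<^bsub>iso_monoid E\<^esub> y \<otimes>\<^bsub>iso_monoid E\<^esub> z = x \<otimes>\<^bsub>iso_monoid E\<^esub> (y \<otimes>\<^bsub>iso_monoid E\<^esub> z)"
    using iso_monoid_mult[OF P(2)] iso_monoid_mult[OF Q(2)] iso_monoid_mult[OF R(2)]
      iso_monoid_mult[OF biproduct_assoc[OF P(2) Q(2) R(2)]] A B C by simp
qed

end

section \<open>An additive invariant with prescribed vanishing\<close>

context exact_category
begin

text \<open>An object isomorphic to \<open>A\<close> is a biproduct of \<open>A\<close> and a zero object, hence an extension of the two.\<close>
lemma iso_closed_if_closed_under_extensions:
  assumes "closed_under_extensions E \<X>" "Z \<in> \<X>" "zero_object E Z" "A \<in> \<X>" "isomorphic E A B"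
  shows "B \<in> \<X>"
proof -
  have "biproduct E A Z B"
    using biproduct_iso[OF biproduct_zero[OF assms(3)] _ _ assms(5)] assms(3,5)
      isomorphic_refl isomorphic_Obj unfolding zero_object_def by blast
  then show ?thesis using ses_biproduct assms unfolding closed_under_extensions_def by blast
qed

text \<open>The group \<open>Q\<close> is the quotient of the monoid of isomorphism classes by the syntactic congruence of
  \<open>\<X>\<close>. Additivity on short exact sequences comes from adding complements to the outer terms, which
  moves the sequence into \<open>\<X>\<close>.\<close>
lemma ex_additive_invariant_detecting:
  assumes "dense_in E \<X>" and "additive_subcategory E \<X>" and ext: "closed_under_extensions E \<X>"
    and two_of_three: "closed_under_kernels E \<X> \<or> closed_under_cokernels E \<X>"
  obtains Q :: "'o set set monoid" and \<phi> where "comm_group Q" "\<phi> ` iso_class E ` Obj E \<subseteq> carrier Q"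
    "\<And>A B C. ses E A B C \<Longrightarrow>
      \<phi> (iso_class E B) = \<phi> (iso_class E A) \<otimes>\<^bsub>Q\<^esub> \<phi> (iso_class E C)"
    "\<And>A. A \<in> Obj E \<Longrightarrow> \<phi> (iso_class E A) = \<one>\<^bsub>Q\<^esub> \<longleftrightarrow> A \<in> \<X>"
proof -
  interpret M: comm_monoid "iso_monoid E" by (rule comm_monoid_iso_monoid)
  note carr = carrier_iso_monoid[of E]
  have XO: "\<X> \<subseteq> Obj E" using assms(2) unfolding additive_subcategory_def by blast
  obtain Z where Z: "Z \<in> \<X>" "zero_object E Z" using assms(2) unfolding additive_subcategory_def by blast
  note iso_closed = iso_closed_if_closed_under_extensions[OF ext Z]
  define S where "S = iso_class E ` \<X>"
  have S_iff: "iso_class E A \<in> S \<longleftrightarrow> A \<in> \<X>" if "A \<in> Obj E" for A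
    using iso_class_eq_iff iso_closed XO that unfolding S_def by blast
  have add_closed: "P \<in> \<X>" if "biproduct E A B P" "A \<in> \<X>" "B \<in> \<X>" for A B P
    using that ses_biproduct ext unfolding closed_under_extensions_def by blast
  have saturated: "A \<in> \<X>" if "biproduct E A B P" "B \<in> \<X>" "P \<in> \<X>" for A B P
    using two_of_three ses_biproduct[OF that(1)] ses_biproduct[OF biproduct_sym[OF that(1)]] that(2,3)
    unfolding closed_under_kernels_def closed_under_cokernels_def by blast
  have complement: "\<exists>B P. biproduct E A B P \<and> P \<in> \<X>" if "A \<in> Obj E" for A
    using assms(1) that unfolding dense_in_def direct_summand_def by blast
  have "\<exists>(Q :: 'o set set monoid) \<phi>. comm_group Q \<and> \<phi> \<in> hom (iso_monoid E) Q \<and>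
    (\<forall>a\<in>carrier (iso_monoid E). \<phi> a = \<one>\<^bsub>Q\<^esub> \<longleftrightarrow> a \<in> S)"
  proof (rule M.ex_group_hom_with_kernel)
    show "S \<subseteq> carrier (iso_monoid E)" using XO by (auto simp: S_def carr)
    show "\<one>\<^bsub>iso_monoid E\<^esub> \<in> S" using Z iso_monoid_one by (auto simp: S_def)
  next
    fix s t assume "s \<in> S" "t \<in> S"
    then obtain A B where AB: "A \<in> \<X>" "B \<in> \<X>" "s = iso_class E A" "t = iso_class E B" by (auto simp: S_def)
    then obtain P where "biproduct E A B P" using ex_biproduct XO by blast
    then show "s \<otimes>\<^bsub>iso_monoid E\<^esub> t \<in> S" using AB add_closed iso_monoid_mult by (auto simp: S_def)
  next
    fix a assume "a \<in> carrier (iso_monoid E)"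
    then obtain A where A: "A \<in> Obj E" "a = iso_class E A" by (auto simp: carr)
    obtain B P where "biproduct E A B P" "P \<in> \<X>" using complement A by blast
    then have "iso_class E B \<in> carrier (iso_monoid E)" "a \<otimes>\<^bsub>iso_monoid E\<^esub> iso_class E B \<in> S"
      using iso_monoid_mult biproduct_Obj A by (auto simp: S_def carr)
    then show "\<exists>b\<in>carrier (iso_monoid E). a \<otimes>\<^bsub>iso_monoid E\<^esub> b \<in> S" by blast
  next
    fix a s assume as: "a \<in> carrier (iso_monoid E)" "s \<in> S" "a \<otimes>\<^bsub>iso_monoid E\<^esub> s \<in> S"
    then obtain A B where AB: "A \<in> Obj E" "a = iso_class E A" "B \<in> \<X>" "s = iso_class E B"
      by (auto simp: carr S_def)
    then obtain P where P: "biproduct E A B P" using ex_biproduct XO by blast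
    then have "P \<in> \<X>" using iso_monoid_mult[OF P] as(3) AB S_iff biproduct_Obj by metis
    then show "a \<in> S" using saturated[OF P] AB by (auto simp: S_def)
  qed
  then obtain Q :: "'o set set monoid" and \<phi> where Q: "comm_group Q" and \<phi>: "\<phi> \<in> hom (iso_monoid E) Q"
    and ker: "\<And>a. a \<in> carrier (iso_monoid E) \<Longrightarrow> \<phi> a = \<one>\<^bsub>Q\<^esub> \<longleftrightarrow> a \<in> S" by blast
  interpret Q: comm_group Q by (rule Q)
  define \<psi> where "\<psi> A = \<phi> (iso_class E A)" for A
  have \<psi>_carr: "\<psi> A \<in> carrier Q" if "A \<in> Obj E" for A
    using \<phi> that unfolding hom_def \<psi>_def carr by auto
  have \<psi>_add: "\<psi> P = \<psi> A \<otimes>\<^bsub>Q\<^esub> \<psi> B" if "biproduct E A B P" for A B P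
    using \<phi> iso_monoid_mult[OF that] biproduct_Obj[OF that] unfolding hom_def \<psi>_def carr by force
  have \<psi>_one: "\<psi> A = \<one>\<^bsub>Q\<^esub> \<longleftrightarrow> A \<in> \<X>" if "A \<in> Obj E" for A
    using ker S_iff that unfolding \<psi>_def carr by auto
  have \<psi>_ses: "\<psi> B = \<psi> A \<otimes>\<^bsub>Q\<^esub> \<psi> C" if "ses E A B C" for A B C
  proof -
    note obj = ses_Obj[OF that]
    obtain A' P where P: "biproduct E A A' P" "P \<in> \<X>" using complement obj by blast
    obtain C' R where R: "biproduct E C C' R" "R \<in> \<X>" using complement obj by blast
    note obj' = biproduct_Obj[OF P(1)] biproduct_Obj[OF R(1)]
    obtain B1 where B1: "biproduct E B A' B1" using ex_biproduct obj obj' by blast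
    obtain B2 where B2: "biproduct E B1 C' B2" using ex_biproduct obj' biproduct_Obj[OF B1] by blast
    \<comment> \<open>the term in the middle is \<open>B \<oplus> A' \<oplus> C'\<close>\<close>
    have "ses E P B2 R"
      using ses_add_right[OF ses_add_left[OF that P(1) B1] B2 R(1)] .
    then have "B2 \<in> \<X>" using ext P R unfolding closed_under_extensions_def by blast
    then have 1: "\<psi> B \<otimes>\<^bsub>Q\<^esub> \<psi> A' \<otimes>\<^bsub>Q\<^esub> \<psi> C' = \<one>\<^bsub>Q\<^esub>" "\<psi> A \<otimes>\<^bsub>Q\<^esub> \<psi> A' = \<one>\<^bsub>Q\<^esub>" "\<psi> C \<otimes>\<^bsub>Q\<^esub> \<psi> C' = \<one>\<^bsub>Q\<^esub>"
      using \<psi>_one \<psi>_add[OF P(1)] \<psi>_add[OF R(1)] \<psi>_add[OF B1] \<psi>_add[OF B2] P R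
        biproduct_Obj[OF B2] obj' by metis+
    note c = \<psi>_carr[OF obj(1)] \<psi>_carr[OF obj(2)] \<psi>_carr[OF obj(3)] \<psi>_carr[OF obj'(2)] \<psi>_carr[OF obj'(5)]
    have "(\<psi> A \<otimes>\<^bsub>Q\<^esub> \<psi> C) \<otimes>\<^bsub>Q\<^esub> (\<psi> A' \<otimes>\<^bsub>Q\<^esub> \<psi> C') = (\<psi> A \<otimes>\<^bsub>Q\<^esub> \<psi> A') \<otimes>\<^bsub>Q\<^esub> (\<psi> C \<otimes>\<^bsub>Q\<^esub> \<psi> C')"
      using c by (simp add: Q.m_ac)
    also have "\<dots> = \<psi> B \<otimes>\<^bsub>Q\<^esub> (\<psi> A' \<otimes>\<^bsub>Q\<^esub> \<psi> C')" using 1 c by (simp add: Q.m_assoc)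
    finally show ?thesis using c Q.right_cancel by (metis Q.m_closed)
  qed
  have "\<phi> ` iso_class E ` Obj E \<subseteq> carrier Q" using \<psi>_carr unfolding \<psi>_def by blast
  then show thesis using that[OF Q] \<psi>_ses \<psi>_one unfolding \<psi>_def by blast
qed

section \<open>The Grothendieck group\<close>

lemma comm_group_iso_free_group: "comm_group (iso_free_group E)"
  unfolding iso_free_group_def by (rule abelian_free_Abelian_group)

lemma iso_free_group_simps:
  "x \<otimes>\<^bsub>iso_free_group E\<^esub> y = x + y" "\<one>\<^bsub>iso_free_group E\<^esub> = 0"
  by (simp_all add: iso_free_group_def)

lemma frag_of_in_iso_free_group: "A \<in> Obj E \<Longrightarrow> frag_of (iso_class E A) \<in> carrier (iso_free_group E)"
  by (simp add: iso_free_group_def)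

lemma iso_free_group_closed:
  assumes "x \<in> carrier (iso_free_group E)" "y \<in> carrier (iso_free_group E)"
  shows "x + y \<in> carrier (iso_free_group E)" "x - y \<in> carrier (iso_free_group E)"
  using assms keys_add[of x y] keys_diff[of x y] by (auto simp: iso_free_group_def)

lemma K0_generators_closed:
  assumes "ses E A B C"
  shows "frag_of (iso_class E A) - frag_of (iso_class E B) + frag_of (iso_class E C)
    \<in> carrier (iso_free_group E)"
  using ses_Obj[OF assms] by (intro iso_free_group_closed frag_of_in_iso_free_group)

lemma K0_relations_normal: "K0_relations E \<lhd> iso_free_group E"
proof -
  interpret F: comm_group "iso_free_group E" by (rule comm_group_iso_free_group)
  have "subgroup (K0_relations E) (iso_free_group E)"
    unfolding K0_relations_def using K0_generators_closed
    by (intro F.generate_is_subgroup) blast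
  then show ?thesis by (rule F.subgroup_imp_normal)
qed

lemma comm_group_K0: "comm_group (K0 E)"
  unfolding K0_def
  using K0_relations_normal comm_group.abelian_FactGroup[OF comm_group_iso_free_group]
    normal_imp_subgroup by blast

lemma K0_class_closed: "A \<in> Obj E \<Longrightarrow> K0_class E A \<in> carrier (K0 E)"
  unfolding K0_class_def K0_def carrier_FactGroup using frag_of_in_iso_free_group by blast

lemma K0_coset_add:
  assumes "x \<in> carrier (iso_free_group E)" "y \<in> carrier (iso_free_group E)"
  shows "(K0_relations E #>\<^bsub>iso_free_group E\<^esub> x) \<otimes>\<^bsub>K0 E\<^esub> (K0_relations E #>\<^bsub>iso_free_group E\<^esub> y)
    = K0_relations E #>\<^bsub>iso_free_group E\<^esub> (x + y)"
  using normal.rcos_sum[OF K0_relations_normal assms]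
  by (simp add: K0_def FactGroup_def iso_free_group_simps)

lemma K0_class_ses:
  assumes "ses E A B C"
  shows "K0_class E B = K0_class E A \<otimes>\<^bsub>K0 E\<^esub> K0_class E C"
proof -
  interpret F: comm_group "iso_free_group E" by (rule comm_group_iso_free_group)
  let ?a = "frag_of (iso_class E A)" and ?b = "frag_of (iso_class E B)" and ?c = "frag_of (iso_class E C)"
  let ?N = "K0_relations E"
  note obj = ses_Obj[OF assms, THEN frag_of_in_iso_free_group]
  have r: "?a - ?b + ?c \<in> ?N" unfolding K0_relations_def using assms by (intro generate.incl) blast
  have "?a + ?c = (?a - ?b + ?c) + ?b" by simp
  then have "?a + ?c \<in> ?N #>\<^bsub>iso_free_group E\<^esub> ?b"
    using r unfolding r_coset_def iso_free_group_simps by blast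
  then have "?N #>\<^bsub>iso_free_group E\<^esub> ?b = ?N #>\<^bsub>iso_free_group E\<^esub> (?a + ?c)"
    using F.repr_independence obj(2) normal_imp_subgroup[OF K0_relations_normal] by blast
  then show ?thesis using K0_coset_add obj unfolding K0_class_def by simp
qed

text \<open>The differences \<open>[A] - [B]\<close> already form a subgroup, because the class of a biproduct is the sum of
  the classes.\<close>
lemma K0_element_as_difference:
  assumes "x \<in> carrier (K0 E)"
  shows "\<exists>A\<in>Obj E. \<exists>B\<in>Obj E. x \<otimes>\<^bsub>K0 E\<^esub> K0_class E B = K0_class E A"
proof -
  interpret F: comm_group "iso_free_group E" by (rule comm_group_iso_free_group)
  interpret K: comm_group "K0 E" by (rule comm_group_K0)
  define \<pi> where "\<pi> c = K0_relations E #>\<^bsub>iso_free_group E\<^esub> c" for c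
  let ?P = "\<lambda>c. c \<in> carrier (iso_free_group E) \<and>
    (\<exists>A\<in>Obj E. \<exists>B\<in>Obj E. \<pi> c \<otimes>\<^bsub>K0 E\<^esub> K0_class E B = K0_class E A)"
  have \<pi>_add: "\<pi> (a + b) = \<pi> a \<otimes>\<^bsub>K0 E\<^esub> \<pi> b"
    if "a \<in> carrier (iso_free_group E)" "b \<in> carrier (iso_free_group E)" for a b
    using K0_coset_add that unfolding \<pi>_def by simp
  have \<pi>_closed: "\<pi> a \<in> carrier (K0 E)" if "a \<in> carrier (iso_free_group E)" for a
    using that unfolding \<pi>_def K0_def carrier_FactGroup by blast
  obtain c where c: "c \<in> carrier (iso_free_group E)" "x = \<pi> c"
    using assms unfolding K0_def carrier_FactGroup \<pi>_def by blast
  then have "Poly_Mapping.keys c \<subseteq> iso_class E ` Obj E" by (simp add: iso_free_group_def)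
  then have "?P c"
  proof (induction rule: frag_induction)
    case zero
    obtain Z where "Z \<in> Obj E" using ex_zero_object unfolding zero_object_def by blast
    moreover have "\<pi> 0 = \<one>\<^bsub>K0 E\<^esub>"
      using \<pi>_add[of 0 0] \<pi>_closed[of 0] K.l_cancel_one F.one_closed by (simp add: iso_free_group_simps)
    ultimately show ?case
      using K0_class_closed F.one_closed by (auto simp: iso_free_group_simps)
  next
    case (one a)
    then obtain A where A: "A \<in> Obj E" "a = iso_class E A" by blast
    \<comment> \<open>\<open>[A] = [A \<oplus> A] - [A]\<close>\<close>
    obtain P where P: "P \<in> Obj E" "biproduct E A A P" using ex_biproduct A by blast
    have "\<pi> (frag_of a) \<otimes>\<^bsub>K0 E\<^esub> K0_class E A = K0_class E P"
      using K0_class_ses[OF ses_biproduct[OF P(2)]] A unfolding \<pi>_def K0_class_def by simp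
    then show ?case using A P frag_of_in_iso_free_group by blast
  next
    case (diff a b)
    then obtain A B C D where
      a: "a \<in> carrier (iso_free_group E)" "A \<in> Obj E" "B \<in> Obj E" "\<pi> a \<otimes>\<^bsub>K0 E\<^esub> K0_class E B = K0_class E A"
      and b: "b \<in> carrier (iso_free_group E)" "C \<in> Obj E" "D \<in> Obj E" "\<pi> b \<otimes>\<^bsub>K0 E\<^esub> K0_class E D = K0_class E C"
      by blast
    \<comment> \<open>\<open>([A] - [B]) - ([C] - [D]) = [A \<oplus> D] - [B \<oplus> C]\<close>\<close>
    obtain P where P: "P \<in> Obj E" "biproduct E A D P" using ex_biproduct a b by blast
    obtain R where R: "R \<in> Obj E" "biproduct E B C R" using ex_biproduct a b by blast
    note cl = a(2,3)[THEN K0_class_closed] b(2,3)[THEN K0_class_closed]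
    have ab: "a - b \<in> carrier (iso_free_group E)" using a b iso_free_group_closed by blast
    then have eq: "\<pi> a = \<pi> (a - b) \<otimes>\<^bsub>K0 E\<^esub> \<pi> b" using \<pi>_add[OF ab b(1)] by simp
    note cl' = \<pi>_closed[OF ab] \<pi>_closed[OF b(1)]
    have "\<pi> (a - b) \<otimes>\<^bsub>K0 E\<^esub> K0_class E R
        = \<pi> (a - b) \<otimes>\<^bsub>K0 E\<^esub> (K0_class E B \<otimes>\<^bsub>K0 E\<^esub> (\<pi> b \<otimes>\<^bsub>K0 E\<^esub> K0_class E D))"
      using K0_class_ses[OF ses_biproduct[OF R(2)]] b(4) by simp
    also have "\<dots> = (\<pi> (a - b) \<otimes>\<^bsub>K0 E\<^esub> \<pi> b) \<otimes>\<^bsub>K0 E\<^esub> K0_class E B \<otimes>\<^bsub>K0 E\<^esub> K0_class E D"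
      using cl cl' by (simp add: K.m_ac)
    also have "\<dots> = K0_class E P"
      unfolding eq[symmetric] a(4) using K0_class_ses[OF ses_biproduct[OF P(2)]] by simp
    finally show ?case using ab P(1) R(1) by blast
  qed
  then show ?thesis using c by blast
qed

lemma K0_universal:
  fixes Q (structure) and \<phi>
  assumes "comm_group Q" and \<phi>: "\<phi> ` iso_class E ` Obj E \<subseteq> carrier Q"
    and add: "\<And>A B C. ses E A B C \<Longrightarrow>
      \<phi> (iso_class E B) = \<phi> (iso_class E A) \<otimes>\<^bsub>Q\<^esub> \<phi> (iso_class E C)"
  obtains h where "h \<in> hom (K0 E) Q" "\<And>A. A \<in> Obj E \<Longrightarrow> h (K0_class E A) = \<phi> (iso_class E A)"
proof -
  interpret F: comm_group "iso_free_group E" by (rule comm_group_iso_free_group)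
  interpret Q: comm_group Q by (rule assms(1))
  obtain g where g: "g \<in> hom (iso_free_group E) Q"
    and g_of: "\<And>x. x \<in> iso_class E ` Obj E \<Longrightarrow> g (frag_of x) = \<phi> x"
    using Q.free_Abelian_group_universal[OF \<phi>] unfolding iso_free_group_def by blast
  interpret g: group_hom "iso_free_group E" Q g by unfold_locales (rule g)
  have "g (frag_of (iso_class E A) - frag_of (iso_class E B) + frag_of (iso_class E C)) = \<one>\<^bsub>Q\<^esub>"
    if "ses E A B C" for A B C
  proof -
    let ?a = "frag_of (iso_class E A)" and ?b = "frag_of (iso_class E B)" and ?c = "frag_of (iso_class E C)"
    note cl = ses_Obj[OF that, THEN frag_of_in_iso_free_group]
    note r = K0_generators_closed[OF that]
    have "g (?a - ?b + ?c) \<otimes>\<^bsub>Q\<^esub> g ?b = g (?a + ?c)"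
      using g.hom_mult[OF r cl(2)] by (simp add: iso_free_group_simps)
    also have "\<dots> = g ?b"
      using g.hom_mult[OF cl(1,3)] add[OF that] g_of ses_Obj[OF that] by (simp add: iso_free_group_simps)
    finally show ?thesis using g.hom_closed[OF r] g.hom_closed[OF cl(2)] Q.r_cancel_one by blast
  qed
  then have "K0_relations E \<subseteq> kernel (iso_free_group E) Q g"
    unfolding K0_relations_def using K0_generators_closed
    by (intro F.generate_subgroup_incl g.subgroup_kernel) (auto simp: kernel_def)
  then obtain h where h: "h \<in> hom (K0 E) Q"
    "\<And>x. x \<in> carrier (iso_free_group E) \<Longrightarrow> h (K0_relations E #>\<^bsub>iso_free_group E\<^esub> x) = g x"
    using g.FactGroup_universal_kernel[OF K0_relations_normal] unfolding K0_def by blast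
  show thesis
    by (rule that[OF h(1)]) (simp add: K0_class_def h(2) frag_of_in_iso_free_group g_of)
qed

section \<open>The correspondence\<close>

text \<open>The invariant that vanishes exactly on \<open>\<X>\<close> factors through \<open>K0 E\<close>; it is trivial on the span
  of \<open>\<X>\<close>, so an object whose class lies in the span belongs to \<open>\<X>\<close>.\<close>
lemma K0_preimage_K0_span:
  assumes "dense_in E \<X>" "additive_subcategory E \<X>" "closed_under_extensions E \<X>"
    and "closed_under_kernels E \<X> \<or> closed_under_cokernels E \<X>"
  shows "K0_preimage E (K0_span E \<X>) = \<X>"
proof -
  interpret K: comm_group "K0 E" by (rule comm_group_K0)
  have XO: "\<X> \<subseteq> Obj E" using assms(2) unfolding additive_subcategory_def by blast
  obtain Q :: "'o set set monoid" and \<phi> where Q: "comm_group Q" "\<phi> ` iso_class E ` Obj E \<subseteq> carrier Q"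
    "\<And>A B C. ses E A B C \<Longrightarrow>
      \<phi> (iso_class E B) = \<phi> (iso_class E A) \<otimes>\<^bsub>Q\<^esub> \<phi> (iso_class E C)"
    and det: "\<And>A. A \<in> Obj E \<Longrightarrow> \<phi> (iso_class E A) = \<one>\<^bsub>Q\<^esub> \<longleftrightarrow> A \<in> \<X>"
    by (rule ex_additive_invariant_detecting[OF assms]) blast
  obtain h where h: "h \<in> hom (K0 E) Q" "\<And>A. A \<in> Obj E \<Longrightarrow> h (K0_class E A) = \<phi> (iso_class E A)"
    by (rule K0_universal[OF Q]) blast+
  interpret Q: comm_group Q by (rule Q(1))
  interpret h: group_hom "K0 E" Q h by unfold_locales (rule h)
  have "K0_class E A \<in> kernel (K0 E) Q h" if "A \<in> \<X>" for A
  proof -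
    have "A \<in> Obj E" using XO that by blast
    then show ?thesis using det[of A] h(2)[of A] K0_class_closed[of A] that by (simp add: kernel_def)
  qed
  then have "K0_span E \<X> \<subseteq> kernel (K0 E) Q h"
    unfolding K0_span_def by (intro K.generate_subgroup_incl h.subgroup_kernel) blast
  then have "A \<in> \<X>" if "A \<in> Obj E" "K0_class E A \<in> K0_span E \<X>" for A
    using that det h(2) unfolding kernel_def by auto
  moreover have "K0_class E A \<in> K0_span E \<X>" if "A \<in> \<X>" for A
    unfolding K0_span_def using that by (intro generate.incl) blast
  ultimately show ?thesis using XO unfolding K0_preimage_def by blast
qed

lemma K0_preimage_subcategory:
  assumes "subgroup H (K0 E)"
  shows "additive_subcategory E (K0_preimage E H)" "closed_under_extensions E (K0_preimage E H)"
    "closed_under_kernels E (K0_preimage E H)" "closed_under_cokernels E (K0_preimage E H)"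
proof -
  interpret K: comm_group "K0 E" by (rule comm_group_K0)
  interpret H: subgroup H "K0 E" by (rule assms)
  have two: "K0_class E B \<in> H \<Longrightarrow> K0_class E C \<in> H \<Longrightarrow> K0_class E A \<in> H"
    "K0_class E A \<in> H \<Longrightarrow> K0_class E B \<in> H \<Longrightarrow> K0_class E C \<in> H"
    "K0_class E A \<in> H \<Longrightarrow> K0_class E C \<in> H \<Longrightarrow> K0_class E B \<in> H" if "ses E A B C" for A B C
  proof -
    note cl = ses_Obj[OF that, THEN K0_class_closed] and eq = K0_class_ses[OF that]
    have 1: "K0_class E A = K0_class E B \<otimes>\<^bsub>K0 E\<^esub> inv\<^bsub>K0 E\<^esub> K0_class E C"
      "K0_class E C = inv\<^bsub>K0 E\<^esub> K0_class E A \<otimes>\<^bsub>K0 E\<^esub> K0_class E B"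
      unfolding eq using cl by (simp_all add: K.m_assoc K.m_assoc[symmetric])
    show "K0_class E B \<in> H \<Longrightarrow> K0_class E C \<in> H \<Longrightarrow> K0_class E A \<in> H"
      by (subst 1(1)) (rule H.m_closed[OF _ H.m_inv_closed])
    show "K0_class E A \<in> H \<Longrightarrow> K0_class E B \<in> H \<Longrightarrow> K0_class E C \<in> H"
      by (subst 1(2)) (rule H.m_closed[OF H.m_inv_closed])
    show "K0_class E A \<in> H \<Longrightarrow> K0_class E C \<in> H \<Longrightarrow> K0_class E B \<in> H"
      unfolding eq by (rule H.m_closed)
  qed
  show "closed_under_extensions E (K0_preimage E H)" "closed_under_kernels E (K0_preimage E H)"
    "closed_under_cokernels E (K0_preimage E H)"
    unfolding closed_under_extensions_def closed_under_kernels_def closed_under_cokernels_def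
      K0_preimage_def using two ses_Obj by blast+
  obtain Z where Z: "zero_object E Z" using ex_zero_object by blast
  then have ZO: "Z \<in> Obj E" unfolding zero_object_def by blast
  have "K0_class E Z = \<one>\<^bsub>K0 E\<^esub>"
    using K0_class_ses[OF ses_biproduct[OF biproduct_zero[OF Z ZO]]] K0_class_closed[OF ZO]
      K.l_cancel_one by metis
  then have "Z \<in> K0_preimage E H" using ZO H.one_closed unfolding K0_preimage_def by simp
  moreover have "\<exists>P\<in>K0_preimage E H. biproduct E A B P"
    if "A \<in> K0_preimage E H" "B \<in> K0_preimage E H" for A B
    using that ex_biproduct[of A B] two(3)[OF ses_biproduct] unfolding K0_preimage_def by blast
  ultimately show "additive_subcategory E (K0_preimage E H)"
    using Z unfolding additive_subcategory_def K0_preimage_def by blast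
qed

text \<open>If \<open>B \<rightarrow> G \<rightarrow> A\<close> or \<open>A \<rightarrow> G \<rightarrow> B\<close> is short exact, then \<open>[A \<oplus> B] = [A] + [B] = [G]\<close> in either case.
  This is where generators and cogenerators become interchangeable.\<close>
lemma ex_complement_in_generators:
  assumes "is_generator E \<G> \<or> is_cogenerator E \<G>" "A \<in> Obj E"
  shows "\<exists>B\<in>Obj E. \<exists>P\<in>Obj E. \<exists>G\<in>\<G>. biproduct E A B P \<and> K0_class E P = K0_class E G"
proof -
  interpret K: comm_group "K0 E" by (rule comm_group_K0)
  obtain B G where BG: "B \<in> Obj E" "G \<in> \<G>" "ses E B G A \<or> ses E A G B"
    using assms unfolding is_generator_def is_cogenerator_def by blast
  obtain P where P: "P \<in> Obj E" "biproduct E A B P" using ex_biproduct BG assms by blast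
  have "K0_class E G = K0_class E A \<otimes>\<^bsub>K0 E\<^esub> K0_class E B"
    using BG(3)
  proof
    assume "ses E B G A"
    then show ?thesis using K0_class_ses K.m_comm[OF K0_class_closed K0_class_closed] assms(2) BG(1) by simp
  qed (rule K0_class_ses)
  then have "K0_class E P = K0_class E G" using K0_class_ses[OF ses_biproduct[OF P(2)]] by simp
  then show ?thesis using BG P by blast
qed

lemma K0_preimage_dense:
  assumes "is_generator E \<G> \<or> is_cogenerator E \<G>" "K0_class E ` \<G> \<subseteq> H"
  shows "dense_in E (K0_preimage E H)"
  unfolding dense_in_def
proof
  fix A assume "A \<in> Obj E"
  then obtain B P G where "B \<in> Obj E" "P \<in> Obj E" "G \<in> \<G>" "biproduct E A B P" "K0_class E P = K0_class E G"
    using ex_complement_in_generators[OF assms(1)] by blast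
  then have "P \<in> K0_preimage E H" "direct_summand E A P"
    using assms(2) unfolding K0_preimage_def direct_summand_def by auto
  then show "\<exists>X\<in>K0_preimage E H. direct_summand E A X" by blast
qed

text \<open>An element \<open>[A] - [B]\<close> of \<open>H\<close> is rewritten as \<open>[A \<oplus> B'] - [B \<oplus> B']\<close>, where \<open>B'\<close> is chosen such that
  \<open>[B \<oplus> B']\<close> is the class of a member of \<open>\<G>\<close>. Then the second term lies in \<open>H\<close>, and hence so does the first.\<close>
lemma K0_span_K0_preimage:
  assumes "is_generator E \<G> \<or> is_cogenerator E \<G>" "\<G> \<subseteq> Obj E"
    and H: "subgroup H (K0 E)" "K0_class E ` \<G> \<subseteq> H"
  shows "K0_span E (K0_preimage E H) = H"
proof
  interpret K: comm_group "K0 E" by (rule comm_group_K0)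
  interpret H: subgroup H "K0 E" by (rule H)
  show "K0_span E (K0_preimage E H) \<subseteq> H"
    unfolding K0_span_def by (rule K.generate_subgroup_incl[OF _ H(1)]) (auto simp: K0_preimage_def)
  show "H \<subseteq> K0_span E (K0_preimage E H)"
  proof
    fix x assume x: "x \<in> H"
    then have xc: "x \<in> carrier (K0 E)" by (rule H.mem_carrier)
    obtain A B where AB: "A \<in> Obj E" "B \<in> Obj E" "x \<otimes>\<^bsub>K0 E\<^esub> K0_class E B = K0_class E A"
      using K0_element_as_difference[OF xc] by blast
    obtain B' P G where P: "B' \<in> Obj E" "P \<in> Obj E" "G \<in> \<G>" "biproduct E B B' P" "K0_class E P = K0_class E G"
      using ex_complement_in_generators[OF assms(1) AB(2)] by blast
    obtain R where R: "R \<in> Obj E" "biproduct E A B' R" using ex_biproduct AB P by blast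
    note cl = AB(1,2)[THEN K0_class_closed] P(1,2)[THEN K0_class_closed] R(1)[THEN K0_class_closed]
    have eq: "K0_class E R = x \<otimes>\<^bsub>K0 E\<^esub> K0_class E P"
      using K0_class_ses[OF ses_biproduct[OF R(2)]] K0_class_ses[OF ses_biproduct[OF P(4)]] cl xc
      by (simp add: K.m_assoc flip: AB(3))
    have PH: "K0_class E P \<in> H" using P H(2) by auto
    then have RH: "K0_class E R \<in> H" unfolding eq using x by (rule H.m_closed[rotated])
    have span: "subgroup (K0_span E (K0_preimage E H)) (K0 E)"
      unfolding K0_span_def using K0_class_closed
      by (intro K.generate_is_subgroup) (auto simp: K0_preimage_def)
    have "K0_class E P \<in> K0_span E (K0_preimage E H)" "K0_class E R \<in> K0_span E (K0_preimage E H)"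
      unfolding K0_span_def using PH RH P(2) R(1) by (auto intro!: generate.incl simp: K0_preimage_def)
    then have "K0_class E R \<otimes>\<^bsub>K0 E\<^esub> inv\<^bsub>K0 E\<^esub> K0_class E P \<in> K0_span E (K0_preimage E H)"
      using span subgroup.m_closed subgroup.m_inv_closed by metis
    moreover have "K0_class E R \<otimes>\<^bsub>K0 E\<^esub> inv\<^bsub>K0 E\<^esub> K0_class E P = x"
      unfolding eq using cl xc by (simp add: K.m_assoc)
    ultimately show "x \<in> K0_span E (K0_preimage E H)" by simp
  qed
qed

lemma subgroup_K0_span: "\<X> \<subseteq> Obj E \<Longrightarrow> subgroup (K0_span E \<X>) (K0 E)"
  unfolding K0_span_def using K0_class_closed
  by (intro group.generate_is_subgroup comm_group.axioms(2) comm_group_K0) blast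

end

lemma mutually_inverse_bijectionsI:
  assumes "\<And>x. x \<in> S \<Longrightarrow> f x \<in> T" "\<And>y. y \<in> T \<Longrightarrow> g y \<in> S"
    "\<And>x. x \<in> S \<Longrightarrow> g (f x) = x" "\<And>y. y \<in> T \<Longrightarrow> f (g y) = y"
  shows "mutually_inverse_bijections f g S T"
  unfolding mutually_inverse_bijections_def
  using bij_betw_byWitness[of S g f T] bij_betw_byWitness[of T f g S] assms by blast

theorem theorem1p2:
  fixes E :: "('o, 'm) exact_data" and \<G> :: "'o set"
  assumes "exact_category E"
    and "\<G> \<subseteq> Obj E"
    and "is_generator E \<G> \<or> is_cogenerator E \<G>"
  shows "mutually_inverse_bijections (K0_span E) (K0_preimage E)
           {\<X>. dense_in E \<X> \<and> resolving E \<G> \<X>}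
           {H. subgroup H (K0 E) \<and> K0_class E ` \<G> \<subseteq> H} \<and>
         mutually_inverse_bijections (K0_span E) (K0_preimage E)
           {\<X>. dense_in E \<X> \<and> coresolving E \<G> \<X>}
           {H. subgroup H (K0 E) \<and> K0_class E ` \<G> \<subseteq> H}"
proof -
  interpret exact_category E by (rule assms(1))
  have span: "subgroup (K0_span E \<X>) (K0 E) \<and> K0_class E ` \<G> \<subseteq> K0_span E \<X>"
    if "additive_subcategory E \<X>" "\<G> \<subseteq> \<X>" for \<X>
    using that subgroup_K0_span[of \<X>] generate.incl[of _ "K0_class E ` \<X>" "K0 E"]
    unfolding additive_subcategory_def K0_span_def by blast
  have preimage: "dense_in E (K0_preimage E H) \<and> resolving E \<G> (K0_preimage E H) \<and>
      coresolving E \<G> (K0_preimage E H)"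
    if "subgroup H (K0 E)" "K0_class E ` \<G> \<subseteq> H" for H
  proof -
    have "\<G> \<subseteq> K0_preimage E H" using that(2) assms(2) unfolding K0_preimage_def by blast
    then show ?thesis
      using K0_preimage_subcategory[OF that(1)] K0_preimage_dense[OF assms(3) that(2)]
      unfolding resolving_def coresolving_def by blast
  qed
  show ?thesis
    by (intro conjI mutually_inverse_bijectionsI;
        use span preimage K0_preimage_K0_span K0_span_K0_preimage[OF assms(3,2)] in
          \<open>auto simp: resolving_def coresolving_def\<close>)
qed

end
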